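(* Let $A,f,\mathcal H,\mathcal Y,n,\mu_0,\psi_0,\psi_0^*$ satisfy the Basic Assumption stated in the context, and let $P_0=\langle\cdot,\psi_0^*\rangle\psi_0$, $Q_0=I-P_0$. Then every solution $(\mu,\psi)$, $\mu\in\mathbb C$, $\psi\in\operatorname{Dom}(A)\cap\mathcal Y$, of the nonlinear eigenvalue problem (with $\varepsilon\in\mathbb R$) $$(A-\mu)\psi-\varepsilon f(\psi)=0,\qquad \langle\psi,\psi_0^*\rangle=1$$ can be written as $$\mu=\mu_0+\varepsilon\nu+\varepsilon^2\sigma,\qquad \psi=\psi_0+\varepsilon\phi+\chi,$$ with $\nu,\sigma\in\mathbb C$ and $\phi,\chi\in Q_0\operatorname{Dom}(A)$, where $$\nu=-\langle f(\psi_0),\psi_0^*\rangle,$$ $\phi$ is the unique (in $Q_0\operatorname{Dom}(A)$) solution of $$(A-\mu_0)\phi=\nu\psi_0+f(\psi_0),$$ and $(\sigma,\chi)$ solves the nonlinear system $$0=\varepsilon\sigma+\langle f(\psi)-f(\psi_0),\psi_0^*\rangle,$$ $$Q_0(A-\mu_0)Q_0\chi=\varepsilon\big[(\nu+\varepsilon\sigma)(\chi+\varepsilon\phi)+Q_0(f(\psi)-f(\psi_0))\big],$$ in which $\psi=\psi_0+\varepsilon\phi+\chi$. Moreover, there exists $\varepsilon_0>0$ such that, for all $\varepsilon\in(-\varepsilon_0,\varepsilon_0)$, this nonlinear system for $(\sigma,\chi)$ has a unique small solution, namely with $$|\sigma|\le r_1,\qquad \|\chi\|_{\mathcal Y}\le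 r_2\varepsilon^2,$$ where $r_1,r_2=O(1)$ (as $\varepsilon\to0$) satisfy $$r_1>k_1L\|P_0\|\,\|\phi\|_{\mathcal Y},\qquad r_2>k_2C_{\mu_0}\big(|\nu|+\|Q_0\|L\big)\|\phi\|_{\mathcal Y}.$$
   Context: Basic Assumption. $A$ is a densely defined closed operator with non-empty resolvent set in a complex Hilbert space $(\mathcal H,\langle\cdot,\cdot\rangle)$ (inner product linear in the first argument) with induced norm $\|\cdot\|$; $f$ is a (generally nonlinear) mapping in $\mathcal H$; $(\mathcal Y,\|\cdot\|_{\mathcal Y})$ is a Banach space; and for $m\in\mathbb N_0$, $\|\phi\|_m:=\sum_{k=0}^m\|A^k\phi\|$ for $\phi\in\operatorname{Dom}(A^m)$ (with $A^0=I$). The following are assumed: (a) $\mathcal Y$ is a linear subspace of $\mathcal H$, for some $n\in\mathbb N$, $n\ge1$, one has $\operatorname{Dom}(A^n)\subset\mathcal Y\subset\operatorname{Dom}(A^{n-1})$, and there are $k_1,k_2>0$ such that $\|\phi\|_{n-1}\le k_1\|\phi\|_{\mathcal Y}\le k_2\|\phi\|_n$ for all $\phi\in\operatorname{Dom}(A^n)$. (b) $\mu_0\in\mathbb C$ is an isolated eigenvalue of $A$ that is simple, i.e. of algebraic multiplicity one; $\psi_0\in\operatorname{Dom}(A)$, $\psi_0^*\in\operatorname{Dom}(A^* )$ satisfy $A\psi_0=\mu_0\psi_0$, $A^*\psi_0^*=\overline{\mu_0}\psi_0^*$, $\|\psi_0\|=1$, $\langle\psi_0,\psi_0^*\rangle=1$.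 (c) $f:\mathcal Y\to\operatorname{Dom}(A^{n-1})$ and there exist $r_L>0$, $L>0$ such that $\|f(\phi)-f(\psi)\|_{n-1}\le k_1L\|\phi-\psi\|_{\mathcal Y}$ for all $\phi,\psi\in\{\eta\in\mathcal Y:\|\eta-\psi_0\|_{\mathcal Y}<r_L\}$. Under (b), $P_0=\langle\cdot,\psi_0^*\rangle\psi_0$ is the spectral (Riesz) projection of $A$ for $\mu_0$, and $Q_0(A-\mu_0)Q_0$, regarded as an operator in $Q_0\mathcal H$ with domain $Q_0\operatorname{Dom}(A)$, is boundedly invertible. The constant $C_{\mu_0}>0$ (depending on $|\mu_0|$, $n$ and $\|(Q_0(A-\mu_0)Q_0)^{-1}\|$) is such that $\|(Q_0(A-\mu_0)Q_0)^{-1}\eta\|_n\le C_{\mu_0}\|\eta\|_{n-1}$ for all $\eta\in Q_0\operatorname{Dom}(A^{n-1})$. $\|P_0\|,\|Q_0\|$ are operator norms on $\mathcal H$.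
   Formalization: At ε=0 the system leaves σ undetermined, so there only existence and uniqueness of χ is claimed (the pair is unique for ε≠0); for ε-dependent r_1, r_2 the strict lower bounds are required uniformly near ε=0. *)

theory Defs
  imports "HOL-Analysis.Analysis" "HOL-Library.Landau_Symbols"
begin

text \<open>
  Complex Hilbert spaces, with the inner product linear in its first argument. Completeness comes
  from the class \<^class>\<open>banach\<close>; the equation \<open>cinner_self\<close> says both that the norm is the one
  induced by the inner product and that the inner product is positive definite.
\<close>

class complex_hilbert_space = banach +
  fixes scaleC :: "complex \<Rightarrow> 'a \<Rightarrow> 'a" (infixr "*\<^sub>C" 75)
    and cinner :: "'a \<Rightarrow> 'a \<Rightarrow> complex"
  assumes scaleC_add_right: "a *\<^sub>C (x + y) = a *\<^sub>C x + a *\<^sub>C y"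
    and scaleC_add_left: "(a + b) *\<^sub>C x = a *\<^sub>C x + b *\<^sub>C x"
    and scaleC_scaleC: "a *\<^sub>C (b *\<^sub>C x) = (a * b) *\<^sub>C x"
    and scaleC_one: "1 *\<^sub>C x = x"
    and scaleR_scaleC: "c *\<^sub>R x = complex_of_real c *\<^sub>C x"
    and cinner_add_left: "cinner (x + y) z = cinner x z + cinner y z"
    and cinner_scaleC_left: "cinner (a *\<^sub>C x) y = a * cinner x y"
    and cinner_commute: "cinner x y = cnj (cinner y x)"
    and cinner_self: "cinner x x = complex_of_real ((norm x)\<^sup>2)"

global_interpretation cvec: vector_space "scaleC :: complex \<Rightarrow> 'h \<Rightarrow> 'h::complex_hilbert_space"
  by unfold_locales (simp_all add: scaleC_add_right scaleC_add_left scaleC_scaleC scaleC_one)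

text \<open>
  A partially defined operator in \<open>'h\<close> is represented by its domain \<open>D\<close> together with a function
  \<open>A\<close> whose values outside \<open>D\<close> are irrelevant.
\<close>

definition densely_defined_closed_operator ::
    "'h::complex_hilbert_space set \<Rightarrow> ('h \<Rightarrow> 'h) \<Rightarrow> bool" where
  "densely_defined_closed_operator D A \<longleftrightarrow>
     cvec.subspace D \<and>
     (\<forall>x\<in>D. \<forall>y\<in>D. A (x + y) = A x + A y) \<and>
     (\<forall>c. \<forall>x\<in>D. A (c *\<^sub>C x) = c *\<^sub>C A x) \<and>
     closure D = UNIV \<and>
     closed {(x, A x) |x. x \<in> D}"

primrec dom_pow :: "'h set \<Rightarrow> ('h \<Rightarrow> 'h) \<Rightarrow> nat \<Rightarrow> 'h set" where
  "dom_pow D A 0 = UNIV"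
| "dom_pow D A (Suc m) = {x \<in> D. A x \<in> dom_pow D A m}"

text \<open>The norm \<open>\<parallel>x\<parallel>\<^sub>m\<close>, meaningful for \<open>x \<in> dom_pow D A m\<close>.\<close>

definition graph_norm :: "('h::complex_hilbert_space \<Rightarrow> 'h) \<Rightarrow> nat \<Rightarrow> 'h \<Rightarrow> real" where
  "graph_norm A m x = (\<Sum>k\<le>m. norm ((A ^^ k) x))"

definition resolvent_set :: "'h::complex_hilbert_space set \<Rightarrow> ('h \<Rightarrow> 'h) \<Rightarrow> complex set" where
  "resolvent_set D A =
     {z. bij_betw (\<lambda>x. A x - z *\<^sub>C x) D UNIV \<and>
         (\<exists>K. \<forall>x\<in>D. norm x \<le> K * norm (A x - z *\<^sub>C x))}"

definition spectrum :: "'h::complex_hilbert_space set \<Rightarrow> ('h \<Rightarrow> 'h) \<Rightarrow> complex set" where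
  "spectrum D A = - resolvent_set D A"

text \<open>\<open>(A - z)\<^sup>-\<^sup>1 y\<close>, for \<open>z\<close> in the resolvent set.\<close>

definition resolvent ::
    "'h::complex_hilbert_space set \<Rightarrow> ('h \<Rightarrow> 'h) \<Rightarrow> complex \<Rightarrow> 'h \<Rightarrow> 'h" where
  "resolvent D A z = inv_into D (\<lambda>x. A x - z *\<^sub>C x)"

definition adjoint_dom :: "'h::complex_hilbert_space set \<Rightarrow> ('h \<Rightarrow> 'h) \<Rightarrow> 'h set" where
  "adjoint_dom D A = {y. \<exists>z. \<forall>x\<in>D. cinner (A x) y = cinner x z}"

definition adjoint_op :: "'h::complex_hilbert_space set \<Rightarrow> ('h \<Rightarrow> 'h) \<Rightarrow> 'h \<Rightarrow> 'h" where
  "adjoint_op D A y = (THE z. \<forall>x\<in>D. cinner (A x) y = cinner x z)"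

definition isolated_eigenvalue ::
    "'h::complex_hilbert_space set \<Rightarrow> ('h \<Rightarrow> 'h) \<Rightarrow> complex \<Rightarrow> bool" where
  "isolated_eigenvalue D A \<mu> \<longleftrightarrow>
     (\<exists>x\<in>D. x \<noteq> 0 \<and> A x = \<mu> *\<^sub>C x) \<and> \<mu> isolated_in spectrum D A"

text \<open>
  The Riesz projection \<open>- (1 / (2 \<pi> i)) \<integral> (A - z)\<^sup>-\<^sup>1 dz\<close> over the positively oriented circle
  \<open>z = \<mu> + r e\<^sup>i\<^sup>t\<close>, where \<open>\<mu>\<close> is the only point of the spectrum in the closed disc of radius \<open>r\<close>.
  The value does not depend on \<open>r\<close>. With \<open>dz = i r e\<^sup>i\<^sup>t dt\<close> the factor \<open>- 1 / (2 \<pi> i)\<close> becomes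
  \<open>- r e\<^sup>i\<^sup>t / (2 \<pi>)\<close>; the integral is taken pointwise on the vectors \<open>x\<close>.
\<close>

definition riesz_projection ::
    "'h::complex_hilbert_space set \<Rightarrow> ('h \<Rightarrow> 'h) \<Rightarrow> complex \<Rightarrow> 'h \<Rightarrow> 'h" where
  "riesz_projection D A \<mu> x =
     (let r = (SOME r. r > 0 \<and> cball \<mu> r \<inter> spectrum D A = {\<mu>})
      in integral {0..2 * pi}
           (\<lambda>t. (- (complex_of_real r * cis t / complex_of_real (2 * pi))) *\<^sub>C
                 resolvent D A (\<mu> + complex_of_real r * cis t) x))"

text \<open>
  The library dimension of an infinite-dimensional space is \<open>0\<close>, so multiplicity \<open>1\<close> does mean
  that the range of the Riesz projection is one-dimensional.
\<close>

definition algebraic_multiplicity ::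
    "'h::complex_hilbert_space set \<Rightarrow> ('h \<Rightarrow> 'h) \<Rightarrow> complex \<Rightarrow> nat" where
  "algebraic_multiplicity D A \<mu> = cvec.dim (range (riesz_projection D A \<mu>))"

text \<open>
  \<open>Y\<close> is a linear subspace of \<open>'h\<close> that is a complex Banach space for a norm \<open>N\<close> of its own
  (the values of \<open>N\<close> outside \<open>Y\<close> are irrelevant).
\<close>

definition banach_subspace :: "'h::complex_hilbert_space set \<Rightarrow> ('h \<Rightarrow> real) \<Rightarrow> bool" where
  "banach_subspace Y N \<longleftrightarrow>
     cvec.subspace Y \<and>
     (\<forall>x\<in>Y. N x \<ge> 0 \<and> (N x = 0 \<longleftrightarrow> x = 0)) \<and>
     (\<forall>c. \<forall>x\<in>Y. N (c *\<^sub>C x) = cmod c * N x) \<and>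
     (\<forall>x\<in>Y. \<forall>y\<in>Y. N (x + y) \<le> N x + N y) \<and>
     (\<forall>X. (\<forall>j::nat. X j \<in> Y) \<and> (\<forall>e>0. \<exists>M. \<forall>i\<ge>M. \<forall>j\<ge>M. N (X i - X j) < e) \<longrightarrow>
          (\<exists>x\<in>Y. (\<lambda>j. N (X j - x)) \<longlonglongrightarrow> 0))"

locale basic_assumption =
  fixes D :: "'h::complex_hilbert_space set"
    and A :: "'h \<Rightarrow> 'h"
    and Y :: "'h set"
    and normY :: "'h \<Rightarrow> real"
    and f :: "'h \<Rightarrow> 'h"
    and n :: nat
    and k1 k2 :: real
    and \<mu>0 :: complex
    and \<psi>0 \<psi>0s :: 'h
    and rL L :: real
  assumes operator: "densely_defined_closed_operator D A"
    and resolvent_nonempty: "resolvent_set D A \<noteq> {}"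
    and Y_banach: "banach_subspace Y normY"
    and n_ge_1: "n \<ge> 1"
    and dom_subset_Y: "dom_pow D A n \<subseteq> Y"
    and Y_subset_dom: "Y \<subseteq> dom_pow D A (n - 1)"
    and k1_pos: "k1 > 0"
    and k2_pos: "k2 > 0"
    and norm_bounds: "\<forall>\<phi>\<in>dom_pow D A n.
           graph_norm A (n - 1) \<phi> \<le> k1 * normY \<phi> \<and> k1 * normY \<phi> \<le> k2 * graph_norm A n \<phi>"
    and isolated: "isolated_eigenvalue D A \<mu>0"
    and simple: "algebraic_multiplicity D A \<mu>0 = 1"
    and \<psi>0_dom: "\<psi>0 \<in> D"
    and \<psi>0_eigen: "A \<psi>0 = \<mu>0 *\<^sub>C \<psi>0"
    and \<psi>0s_dom: "\<psi>0s \<in> adjoint_dom D A"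
    and \<psi>0s_eigen: "adjoint_op D A \<psi>0s = cnj \<mu>0 *\<^sub>C \<psi>0s"
    and \<psi>0_norm: "norm \<psi>0 = 1"
    and \<psi>0_\<psi>0s: "cinner \<psi>0 \<psi>0s = 1"
    and f_range: "f ` Y \<subseteq> dom_pow D A (n - 1)"
    and rL_pos: "rL > 0"
    and L_pos: "L > 0"
    and f_lipschitz: "\<forall>\<phi>\<in>Y. \<forall>\<psi>\<in>Y. normY (\<phi> - \<psi>0) < rL \<and> normY (\<psi> - \<psi>0) < rL \<longrightarrow>
           graph_norm A (n - 1) (f \<phi> - f \<psi>) \<le> k1 * L * normY (\<phi> - \<psi>)"

text \<open>
  \<open>P0_proj \<psi>0 \<psi>0s\<close> and \<open>Q0_proj \<psi>0 \<psi>0s\<close> are \<open>P\<^sub>0 = \<langle>\<cdot>, \<psi>\<^sub>0\<^sup>*\<rangle> \<psi>\<^sub>0\<close> and \<open>Q\<^sub>0 = I - P\<^sub>0\<close>.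
\<close>

definition P0_proj :: "'h::complex_hilbert_space \<Rightarrow> 'h \<Rightarrow> 'h \<Rightarrow> 'h" where
  "P0_proj \<psi>0 \<psi>0s x = cinner x \<psi>0s *\<^sub>C \<psi>0"

definition Q0_proj :: "'h::complex_hilbert_space \<Rightarrow> 'h \<Rightarrow> 'h \<Rightarrow> 'h" where
  "Q0_proj \<psi>0 \<psi>0s x = x - P0_proj \<psi>0 \<psi>0s x"

text \<open>The operator \<open>Q (A - \<mu>) Q\<close>, to be regarded as an operator in \<open>range Q\<close> with domain \<open>Q ` D\<close>.\<close>

definition compressed_op ::
    "('h::complex_hilbert_space \<Rightarrow> 'h) \<Rightarrow> complex \<Rightarrow> ('h \<Rightarrow> 'h) \<Rightarrow> 'h \<Rightarrow> 'h" where
  "compressed_op A \<mu> Q x = Q (A (Q x) - \<mu> *\<^sub>C Q x)"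

definition compressed_inverse ::
    "'h::complex_hilbert_space set \<Rightarrow> ('h \<Rightarrow> 'h) \<Rightarrow> complex \<Rightarrow> ('h \<Rightarrow> 'h) \<Rightarrow> 'h \<Rightarrow> 'h" where
  "compressed_inverse D A \<mu> Q = inv_into (Q ` D) (compressed_op A \<mu> Q)"

text \<open>
  The nonlinear system for \<open>(\<sigma>, \<xi>)\<close>; the corrector is called \<open>\<xi>\<close> because the letter chi is
  the vector binder of HOL-Analysis. It only makes sense for \<open>\<psi>\<^sub>0 + \<epsilon> \<phi> + \<xi> \<in> Y\<close>, since \<open>f\<close> is
  defined on \<open>Y\<close> only; this is therefore part of being a solution.
\<close>

definition solves_system ::
    "'h::complex_hilbert_space set \<Rightarrow> ('h \<Rightarrow> 'h) \<Rightarrow> 'h set \<Rightarrow> ('h \<Rightarrow> 'h) \<Rightarrow> complex \<Rightarrow> 'h \<Rightarrow> 'h \<Rightarrow>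
     complex \<Rightarrow> 'h \<Rightarrow> real \<Rightarrow> complex \<Rightarrow> 'h \<Rightarrow> bool" where
  "solves_system D A Y f \<mu>0 \<psi>0 \<psi>0s \<nu> \<phi> \<epsilon> \<sigma> \<xi> \<longleftrightarrow>
     (let Q = Q0_proj \<psi>0 \<psi>0s;
          \<psi> = \<psi>0 + \<epsilon> *\<^sub>R \<phi> + \<xi>
      in \<xi> \<in> Q ` D \<and> \<psi> \<in> Y \<and>
         0 = complex_of_real \<epsilon> * \<sigma> + cinner (f \<psi> - f \<psi>0) \<psi>0s \<and>
         compressed_op A \<mu>0 Q \<xi> =
           \<epsilon> *\<^sub>R ((\<nu> + complex_of_real \<epsilon> * \<sigma>) *\<^sub>C (\<xi> + \<epsilon> *\<^sub>R \<phi>) + Q (f \<psi> - f \<psi>0)))"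

end

theory Submission
  imports Defs
begin

text \<open>
  Since \<open>\<psi>\<^sub>0\<^sup>*\<close> is a left eigenvector, \<open>\<langle>P x, \<psi>\<^sub>0\<^sup>*\<rangle> = \<langle>x, \<psi>\<^sub>0\<^sup>*\<rangle>\<close> for the Riesz projection \<open>P\<close>; as the
  range of \<open>P\<close> is spanned by \<open>\<psi>\<^sub>0\<close>, this forces \<open>P = P\<^sub>0\<close>. The reduced resolvent, an integral over
  the same circle, then solves \<open>(A - \<mu>\<^sub>0) x = Q\<^sub>0 y\<close>, which gives \<open>\<phi>\<close> and turns the nonlinear system
  into the fixed point equation \<open>\<xi> = (Q\<^sub>0 (A - \<mu>\<^sub>0) Q\<^sub>0)\<^sup>-\<^sup>1 (\<epsilon> G \<xi>)\<close>, where \<open>\<sigma>\<close> has been eliminated by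
  the scalar equation. For small \<open>\<epsilon>\<close> the right-hand side is a contraction of the set of those
  \<open>\<xi>\<close> in \<open>Q\<^sub>0 Dom(A\<^sup>n)\<close> whose \<open>Y\<close>-norm is at most \<open>r\<^sub>2 \<epsilon>\<^sup>2\<close>.
\<close>

section \<open>Complex Hilbert spaces\<close>

text \<open>The domains fit because one power of \<open>A\<close> is lost and regained:
  \<open>f\<close> maps \<open>Y\<close> only into Dom(A^(n-1)), while the inverse \<open>S\<close>
  gains a power. So the iteration can run in Dom(A^n), and the same gain places every solution of
  the system there. Passing from \<open>normY\<close> to the graph norm of order n - 1 costs
  \<open>k1\<close>, returning from order n costs \<open>k2 / k1\<close>, so one cycle carries the
  factor \<open>k2 * C\<close>. As \<open>\<epsilon> *\<^sub>R \<phi>\<close> dominates the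
  corrector, the image of the ball has \<open>Y\<close>-norm at most about \<epsilon>^2 times the
  threshold imposed on \<open>r2\<close>; the threshold for \<open>r1\<close> is likewise the limit
  of the bound for the scalar term divided by |\<epsilon>|. The fixed margins \<rho>1 and \<rho>2
  above these limits absorb all remaining terms for small \<epsilon>. At \<epsilon> = 0 the scalar
  equation does not involve \<sigma>, so only the corrector can be unique there.\<close>

lemmas scaleC_distribs =
  cvec.scale_left_distrib cvec.scale_right_distrib
  cvec.scale_left_diff_distrib cvec.scale_right_diff_distrib

lemma cinner_scaleC_right:
  fixes x y :: "'h::complex_hilbert_space"
  shows "cinner x (a *\<^sub>C y) = cnj a * cinner x y"
  by (metis cinner_commute cinner_scaleC_left complex_cnj_mult)

lemma cinner_add_right:
  fixes x y z :: "'h::complex_hilbert_space"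
  shows "cinner x (y + z) = cinner x y + cinner x z"
  by (metis cinner_commute cinner_add_left complex_cnj_add)

lemma cinner_zero_left [simp]: "cinner 0 (y::'h::complex_hilbert_space) = 0"
  using cinner_scaleC_left[of 0 0 y] by simp

lemma cinner_diff_left:
  fixes x y z :: "'h::complex_hilbert_space"
  shows "cinner (x - y) z = cinner x z - cinner y z"
  using cinner_add_left[of "x - y" y z] by simp

lemma cinner_diff_right:
  fixes x y z :: "'h::complex_hilbert_space"
  shows "cinner x (y - z) = cinner x y - cinner x z"
  using cinner_add_right[of x "y - z" z] by simp

text \<open>Both entries of \<open>cinner_self\<close> release the scalar, and
  \<open>a * cnj a\<close> is the square of its modulus.\<close>

lemma norm_scaleC:
  fixes x :: "'h::complex_hilbert_space"
  shows "norm (a *\<^sub>C x) = cmod a * norm x"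
proof -
  have "complex_of_real ((norm (a *\<^sub>C x))\<^sup>2) = a * (cnj a * cinner x x)"
    by (metis cinner_self cinner_scaleC_left cinner_scaleC_right)
  also have "\<dots> = complex_of_real ((cmod a * norm x)\<^sup>2)"
    by (simp add: cinner_self power_mult_distrib complex_norm_square mult.assoc [symmetric]
        del: of_real_power)
  finally have "(norm (a *\<^sub>C x))\<^sup>2 = (cmod a * norm x)\<^sup>2"
    using of_real_eq_iff by blast
  then show ?thesis
    by (simp add: power2_eq_iff_nonneg)
qed

text \<open>The Cauchy-Schwarz inequality: the squared distance from \<open>x\<close> to the line
  through \<open>y\<close> is nonnegative.\<close>

lemma norm_cinner_le:
  fixes x y :: "'h::complex_hilbert_space"
  shows "cmod (cinner x y) \<le> norm x * norm y"
proof (cases "y = 0")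
  case True
  then show ?thesis
    by (metis cinner_commute cinner_zero_left complex_cnj_zero mult_zero_right norm_zero order_refl)
next
  case False
  define N where "N = (norm y)\<^sup>2"
  have N: "N > 0"
    using False by (simp add: N_def)
  \<comment> \<open>With this coefficient \<open>x - c *\<^sub>C y\<close> is orthogonal to
    \<open>y\<close>, so the last bracket of the expansion vanishes.\<close>
  define c where "c = cinner x y / of_real N"
  have "complex_of_real ((norm (x - c *\<^sub>C y))\<^sup>2) =
      cinner x x - cnj c * cinner x y - c * (cinner y x - cnj c * cinner y y)"
    by (simp add: cinner_self[symmetric] cinner_diff_left cinner_diff_right cinner_scaleC_left
        cinner_scaleC_right algebra_simps del: of_real_power)
  also have "cinner y x - cnj c * cinner y y = 0"
    using N by (simp add: c_def cinner_self N_def[symmetric] cinner_commute[of y x] del: of_real_power)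
  also have "cinner x x - cnj c * cinner x y - c * 0
      = complex_of_real ((norm x)\<^sup>2 - (cmod (cinner x y))\<^sup>2 / N)"
    using N by (simp add: c_def cinner_self complex_norm_square[symmetric] mult.commute)
  finally have "(norm (x - c *\<^sub>C y))\<^sup>2 = (norm x)\<^sup>2 - (cmod (cinner x y))\<^sup>2 / N"
    using of_real_eq_iff by blast
  then have "(cmod (cinner x y))\<^sup>2 / N \<le> (norm x)\<^sup>2"
    by (metis diff_ge_0_iff_ge zero_le_power2)
  then have "(cmod (cinner x y))\<^sup>2 \<le> (norm x * norm y)\<^sup>2"
    using N by (simp add: pos_divide_le_eq power_mult_distrib N_def)
  then show ?thesis
    by (rule power2_le_imp_le) simp
qed

lemma bounded_linear_cinner_left:
  "bounded_linear (\<lambda>x. cinner x (y::'h::complex_hilbert_space))"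
  by (rule bounded_linear_intro[where K = "norm y"])
    (simp_all add: cinner_add_left scaleR_scaleC cinner_scaleC_left norm_cinner_le scaleR_conv_of_real)

lemma bounded_bilinear_scaleC:
  "bounded_bilinear (scaleC :: complex \<Rightarrow> 'h \<Rightarrow> 'h::complex_hilbert_space)"
proof
  show "\<exists>K. \<forall>a b. norm (a *\<^sub>C (b::'h)) \<le> norm a * norm b * K"
    by (rule exI[of _ 1]) (simp add: norm_scaleC)
qed (simp_all add: scaleC_distribs scaleR_scaleC scaleR_conv_of_real mult.commute)

lemma P0_proj_bounded_linear: "bounded_linear (P0_proj x (y::'h::complex_hilbert_space))"
  unfolding P0_proj_def
  by (intro bounded_linear_compose[OF bounded_bilinear.bounded_linear_left[OF bounded_bilinear_scaleC]]
      bounded_linear_cinner_left)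

lemma Q0_proj_bounded_linear: "bounded_linear (Q0_proj x (y::'h::complex_hilbert_space))"
  unfolding Q0_proj_def by (intro bounded_linear_sub bounded_linear_ident P0_proj_bounded_linear)

section \<open>Powers of a closed operator\<close>

lemma graph_norm_nonneg: "graph_norm A m x \<ge> 0"
  unfolding graph_norm_def by (simp add: sum_nonneg)

lemma norm_le_graph_norm: "norm x \<le> graph_norm A m x"
proof -
  have "norm ((A ^^ 0) x) \<le> graph_norm A m x"
    unfolding graph_norm_def by (rule member_le_sum) auto
  then show ?thesis by simp
qed

text \<open>On \<open>dom_pow D A m\<close> this is \<open>graph_norm A m (x - y)\<close>; in the present form it is symmetric
  and satisfies the triangle inequality for all vectors.\<close>

definition graph_dist :: "('h::complex_hilbert_space \<Rightarrow> 'h) \<Rightarrow> nat \<Rightarrow> 'h \<Rightarrow> 'h \<Rightarrow> real" where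
  "graph_dist A m x y = (\<Sum>k\<le>m. norm ((A ^^ k) x - (A ^^ k) y))"

lemma graph_dist_eq_0: "graph_dist A m x y = 0 \<Longrightarrow> x = y"
  unfolding graph_dist_def by (subst (asm) sum_nonneg_eq_0_iff) (auto dest: bspec[of _ _ 0])

lemma graph_dist_triangle: "graph_dist A m x z \<le> graph_dist A m x y + graph_dist A m y z"
  unfolding graph_dist_def sum.distrib[symmetric]
  by (intro sum_mono) (metis dist_norm dist_triangle)

lemma graph_dist_commute: "graph_dist A m x y = graph_dist A m y x"
  unfolding graph_dist_def by (simp add: norm_minus_commute)

lemma Metric_space_graph_dist: "Metric_space M (graph_dist A m)"
proof
  show "0 \<le> graph_dist A m x y" for x y
    by (simp add: graph_dist_def sum_nonneg)
  show "graph_dist A m x y = 0 \<longleftrightarrow> x = y" for x y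
    using graph_dist_eq_0 by (auto simp: graph_dist_def)
qed (auto intro: graph_dist_commute graph_dist_triangle)

lemma dom_pow_antimono: "m \<le> k \<Longrightarrow> dom_pow D A k \<subseteq> dom_pow D A m"
proof (induction m arbitrary: k)
  case (Suc m)
  then obtain l where "k = Suc l" "m \<le> l"
    by (cases k) auto
  then show ?case
    using Suc.IH[of l] by auto
qed simp

locale closed_operator =
  fixes D :: "'h::complex_hilbert_space set" and A :: "'h \<Rightarrow> 'h"
  assumes op: "densely_defined_closed_operator D A"
begin

lemma subspace_D: "cvec.subspace D"
  using op by (simp add: densely_defined_closed_operator_def)

lemma A_add: "x \<in> D \<Longrightarrow> y \<in> D \<Longrightarrow> A (x + y) = A x + A y"
  and A_scaleC: "x \<in> D \<Longrightarrow> A (c *\<^sub>C x) = c *\<^sub>C A x"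
  using op by (auto simp: densely_defined_closed_operator_def)

lemma A_diff: "x \<in> D \<Longrightarrow> y \<in> D \<Longrightarrow> A (x - y) = A x - A y"
  using A_add[of "x - y" y] cvec.subspace_diff[OF subspace_D] by simp

lemma A_zero: "A 0 = 0"
  using A_scaleC[of 0 0] cvec.subspace_0[OF subspace_D] by simp

lemma graph_closed:
  assumes "\<And>j. X j \<in> D" "X \<longlonglongrightarrow> x" "(\<lambda>j. A (X j)) \<longlonglongrightarrow> y"
  shows "x \<in> D \<and> A x = y"
proof -
  have "closed {(x, A x) |x. x \<in> D}"
    using op by (simp add: densely_defined_closed_operator_def)
  moreover have "(\<lambda>j. (X j, A (X j))) \<longlonglongrightarrow> (x, y)"
    by (intro tendsto_Pair assms)
  ultimately have "(x, y) \<in> {(x, A x) |x. x \<in> D}"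
    using closed_sequentially[of _ "\<lambda>j. (X j, A (X j))"] assms(1) by blast
  then show ?thesis by auto
qed

lemma subspace_dom_pow: "cvec.subspace (dom_pow D A m)"
proof (induction m)
  case 0
  then show ?case by simp
next
  case (Suc m)
  then show ?case
    using subspace_D unfolding cvec.subspace_def by (auto simp: A_add A_scaleC A_zero)
qed

lemma funpow_dom_pow: "x \<in> dom_pow D A m \<Longrightarrow> k \<le> m \<Longrightarrow> (A ^^ k) x \<in> dom_pow D A (m - k)"
proof (induction k arbitrary: x m)
  case (Suc k)
  then obtain l where "m = Suc l"
    by (cases m) auto
  with Suc show ?case
    by (auto simp: funpow_swap1 simp del: funpow.simps simp add: funpow_Suc_right)
qed simp

lemma funpow_add_dom_pow:
  "\<lbrakk>x \<in> dom_pow D A m; y \<in> dom_pow D A m; k \<le> m\<rbrakk> \<Longrightarrow> (A ^^ k) (x + y) = (A ^^ k) x + (A ^^ k) y"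
proof (induction k arbitrary: x y m)
  case (Suc k)
  then obtain l where "m = Suc l"
    by (cases m) auto
  with Suc show ?case
    by (auto simp: A_add simp del: funpow.simps simp add: funpow_Suc_right)
qed simp

lemma funpow_scaleC_dom_pow:
  "\<lbrakk>x \<in> dom_pow D A m; k \<le> m\<rbrakk> \<Longrightarrow> (A ^^ k) (c *\<^sub>C x) = c *\<^sub>C (A ^^ k) x"
proof (induction k arbitrary: x m)
  case (Suc k)
  then obtain l where "m = Suc l"
    by (cases m) auto
  with Suc show ?case
    by (auto simp: A_scaleC simp del: funpow.simps simp add: funpow_Suc_right)
qed simp

lemma funpow_diff_dom_pow:
  "\<lbrakk>x \<in> dom_pow D A m; y \<in> dom_pow D A m; k \<le> m\<rbrakk> \<Longrightarrow> (A ^^ k) (x - y) = (A ^^ k) x - (A ^^ k) y"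
  using funpow_add_dom_pow[of "x - y" m y k] cvec.subspace_diff[OF subspace_dom_pow, of x m y]
  by simp

lemma graph_norm_add_le:
  assumes "x \<in> dom_pow D A m" "y \<in> dom_pow D A m"
  shows "graph_norm A m (x + y) \<le> graph_norm A m x + graph_norm A m y"
  unfolding graph_norm_def sum.distrib[symmetric]
  using assms by (intro sum_mono) (simp add: funpow_add_dom_pow norm_triangle_ineq)

lemma graph_norm_scaleC:
  assumes "x \<in> dom_pow D A m"
  shows "graph_norm A m (c *\<^sub>C x) = cmod c * graph_norm A m x"
  unfolding graph_norm_def sum_distrib_left
  using assms by (intro sum.cong) (simp_all add: funpow_scaleC_dom_pow norm_scaleC)

lemma graph_norm_scaleR:
  assumes "x \<in> dom_pow D A m"
  shows "graph_norm A m (c *\<^sub>R x) = \<bar>c\<bar> * graph_norm A m x"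
  using graph_norm_scaleC[OF assms, of "complex_of_real c"] by (simp add: scaleR_scaleC)

lemma graph_norm_diff:
  assumes "x \<in> dom_pow D A m" "y \<in> dom_pow D A m"
  shows "graph_norm A m (x - y) = graph_dist A m x y"
  unfolding graph_norm_def graph_dist_def
  using assms by (intro sum.cong) (simp_all add: funpow_diff_dom_pow)

text \<open>Each sequence of k-th powers converges in the Hilbert space, and closedness of
  \<open>A\<close> links consecutive limits. This supplies the complete space for the fixed point
  argument.\<close>

lemma dom_pow_complete:
  assumes X: "\<And>j::nat. X j \<in> dom_pow D A m"
    and Cauchy: "\<And>e. e > 0 \<Longrightarrow> \<exists>N. \<forall>i\<ge>N. \<forall>j\<ge>N. graph_dist A m (X i) (X j) < e"
  shows "\<exists>x\<in>dom_pow D A m. (\<lambda>j. graph_dist A m (X j) x) \<longlonglongrightarrow> 0"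
proof -
  have "convergent (\<lambda>j. (A ^^ k) (X j))" if "k \<le> m" for k
  proof (rule Cauchy_convergent, rule metric_CauchyI)
    fix e :: real assume "e > 0"
    then obtain N where N: "\<forall>i\<ge>N. \<forall>j\<ge>N. graph_dist A m (X i) (X j) < e"
      using Cauchy by blast
    have "dist ((A ^^ k) (X i)) ((A ^^ k) (X j)) \<le> graph_dist A m (X i) (X j)" for i j
      unfolding graph_dist_def dist_norm using that
      by (intro member_le_sum[of k "{..m}" "\<lambda>k. norm ((A ^^ k) (X i) - (A ^^ k) (X j))"]) auto
    with N show "\<exists>N. \<forall>i\<ge>N. \<forall>j\<ge>N. dist ((A ^^ k) (X i)) ((A ^^ k) (X j)) < e"
      by (meson le_less_trans)
  qed
  then obtain y where y: "\<And>k. k \<le> m \<Longrightarrow> (\<lambda>j. (A ^^ k) (X j)) \<longlonglongrightarrow> y k"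
    unfolding convergent_def by metis
  have step: "y k \<in> D \<and> A (y k) = y (Suc k)" if "k < m" for k
  proof (rule graph_closed)
    show "(A ^^ k) (X j) \<in> D" for j
      using funpow_dom_pow[OF X, of k j] that
      by (cases "m - k") auto
    show "(\<lambda>j. (A ^^ k) (X j)) \<longlonglongrightarrow> y k" "(\<lambda>j. A ((A ^^ k) (X j))) \<longlonglongrightarrow> y (Suc k)"
      using y[of k] y[of "Suc k"] that by auto
  qed
  have pow: "(A ^^ k) (y 0) = y k" if "k \<le> m" for k
    using that by (induction k) (auto simp: step)
  \<comment> \<open>The induction descends from the top limit \<open>y m\<close>, about which
    nothing is required, to \<open>y 0\<close>, gaining one application of \<open>A\<close> at a
    time.\<close>
  have "k \<le> m \<Longrightarrow> y (m - k) \<in> dom_pow D A k" for k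
  proof (induction k)
    case (Suc k)
    then show ?case
      using step[of "m - Suc k"] by (auto simp: Suc_diff_Suc)
  qed simp
  from this[of m] have "y 0 \<in> dom_pow D A m" by simp
  moreover have "(\<lambda>j. graph_dist A m (X j) (y 0)) \<longlonglongrightarrow> (\<Sum>k\<le>m. norm (y k - y k))"
    unfolding graph_dist_def
  proof (intro tendsto_sum tendsto_norm tendsto_diff)
    fix k assume "k \<in> {..m}"
    then show "(\<lambda>j. (A ^^ k) (X j)) \<longlonglongrightarrow> y k" "(\<lambda>j. (A ^^ k) (y 0)) \<longlonglongrightarrow> y k"
      using y[of k] pow[of k] by auto
  qed
  ultimately show ?thesis by auto
qed

section \<open>The resolvent and the Riesz projection\<close>

lemma resolvent_dom: "z \<in> resolvent_set D A \<Longrightarrow> resolvent D A z y \<in> D"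
  and resolvent_eq:
    "z \<in> resolvent_set D A \<Longrightarrow> A (resolvent D A z y) = y + z *\<^sub>C resolvent D A z y"
proof -
  assume "z \<in> resolvent_set D A"
  then have "(\<lambda>x. A x - z *\<^sub>C x) ` D = UNIV"
    by (auto simp: resolvent_set_def bij_betw_def)
  then have *: "y \<in> (\<lambda>x. A x - z *\<^sub>C x) ` D" by blast
  show "resolvent D A z y \<in> D"
    unfolding resolvent_def by (rule inv_into_into[OF *])
  show "A (resolvent D A z y) = y + z *\<^sub>C resolvent D A z y"
    using f_inv_into_f[OF *] unfolding resolvent_def[symmetric] by (metis diff_add_cancel)
qed

lemma resolvent_unique:
  assumes "z \<in> resolvent_set D A" "x \<in> D" "A x = y + z *\<^sub>C x"
  shows "resolvent D A z y = x"
  using assms unfolding resolvent_set_def resolvent_def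
  by (metis (no_types, lifting) add_diff_cancel_right' bij_betw_imp_inj_on inv_into_f_eq mem_Collect_eq)

lemma resolvent_eigenvector:
  assumes "z \<in> resolvent_set D A" "x \<in> D" "A x = \<mu> *\<^sub>C x" "z \<noteq> \<mu>"
  shows "resolvent D A z x = (1 / (\<mu> - z)) *\<^sub>C x"
proof (rule resolvent_unique[OF assms(1)])
  show "(1 / (\<mu> - z)) *\<^sub>C x \<in> D"
    by (simp add: assms cvec.subspace_scale[OF subspace_D])
  have "1 + z * (1 / (\<mu> - z)) = 1 / (\<mu> - z) * \<mu>"
    using assms(4) by (simp add: field_simps)
  then show "A ((1 / (\<mu> - z)) *\<^sub>C x) = x + z *\<^sub>C (1 / (\<mu> - z)) *\<^sub>C x"
    using scaleC_add_left[of 1 "z * (1 / (\<mu> - z))" x] by (simp add: A_scaleC assms)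
qed

lemma bounded_linear_resolvent:
  assumes z: "z \<in> resolvent_set D A"
  shows "bounded_linear (resolvent D A z)"
proof -
  obtain K where K: "\<And>x. x \<in> D \<Longrightarrow> norm x \<le> K * norm (A x - z *\<^sub>C x)"
    using z by (auto simp: resolvent_set_def)
  note res = resolvent_dom[OF z] resolvent_eq[OF z]
  show ?thesis
  proof (rule bounded_linear_intro)
    fix x y :: 'h and r :: real
    show "resolvent D A z (x + y) = resolvent D A z x + resolvent D A z y"
      by (rule resolvent_unique[OF z])
        (simp_all add: res cvec.subspace_add[OF subspace_D] A_add scaleC_distribs)
    show "resolvent D A z (r *\<^sub>R x) = r *\<^sub>R resolvent D A z x"
      by (rule resolvent_unique[OF z])
        (simp_all add: res scaleR_scaleC cvec.subspace_scale[OF subspace_D] A_scaleC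
          scaleC_distribs mult.commute)
    show "norm (resolvent D A z x) \<le> norm x * K"
      using K[of "resolvent D A z x"] by (simp add: res mult.commute)
  qed
qed

text \<open>The difference \<open>u\<close> of two resolvent values solves (A - w) u = (z - w) (u +
  R(w) y). Both points are already in the resolvent set, so the term with \<open>u\<close> on the
  right is simply absorbed once \<open>z\<close> is close to \<open>w\<close>.\<close>

lemma continuous_on_resolvent: "continuous_on (resolvent_set D A) (\<lambda>z. resolvent D A z y)"
  unfolding continuous_on_iff
proof (intro ballI allI impI)
  fix w and e :: real assume w: "w \<in> resolvent_set D A" and e: "e > 0"
  obtain K0 where K0: "\<And>x. x \<in> D \<Longrightarrow> norm x \<le> K0 * norm (A x - w *\<^sub>C x)"
    using w by (auto simp: resolvent_set_def)
  define K where "K = max K0 1"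
  have K: "norm x \<le> K * norm (A x - w *\<^sub>C x)" if "x \<in> D" for x
    using K0[OF that] mult_right_mono[of K0 K "norm (A x - w *\<^sub>C x)"] by (simp add: K_def)
  have "K > 0" by (simp add: K_def)
  define R where "R = norm (resolvent D A w y)"
  have R: "R \<ge> 0" by (simp add: R_def)
  \<comment> \<open>The first entry makes the absorbed coefficient less than 1/2, the second makes
    twice the remainder less than \<open>e\<close>; \<open>R + 1\<close> keeps the denominator
    positive when \<open>R\<close> is zero.\<close>
  define d where "d = min (1 / (2 * K)) (e / (2 * K * (R + 1)))"
  have "d > 0" using e \<open>K > 0\<close> R by (simp add: d_def)
  moreover have "dist (resolvent D A z y) (resolvent D A w y) < e"
    if z: "z \<in> resolvent_set D A" and zd: "dist z w < d" for z
  proof -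
    define u where "u = resolvent D A z y - resolvent D A w y"
    have u: "u \<in> D"
      using resolvent_dom[OF z] resolvent_dom[OF w]
      by (simp add: u_def cvec.subspace_diff[OF subspace_D])
    have "A u - w *\<^sub>C u = (z - w) *\<^sub>C (u + resolvent D A w y)"
      using resolvent_dom[OF z] resolvent_dom[OF w]
      by (simp add: u_def A_diff resolvent_eq[OF z] resolvent_eq[OF w] scaleC_distribs)
    then have "norm u \<le> K * (cmod (z - w) * norm (u + resolvent D A w y))"
      using K[OF u] by (simp add: norm_scaleC)
    also have "\<dots> \<le> K * (cmod (z - w) * (norm u + R))"
      using \<open>K > 0\<close> by (intro mult_left_mono) (simp_all add: R_def norm_triangle_ineq)
    finally have 1: "norm u \<le> (K * cmod (z - w)) * norm u + (K * cmod (z - w)) * R"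
      by (simp add: algebra_simps)
    have "cmod (z - w) < 1 / (2 * K)" "cmod (z - w) < e / (2 * K * (R + 1))"
      using zd by (auto simp: d_def dist_norm)
    then have "cmod (z - w) * (2 * K) < 1" "cmod (z - w) * (2 * K * (R + 1)) < e"
      using \<open>K > 0\<close> R by (simp_all add: pos_less_divide_eq)
    then have 2: "K * cmod (z - w) < 1 / 2" and "2 * ((K * cmod (z - w)) * (R + 1)) < e"
      by (simp_all add: algebra_simps)
    moreover have "(K * cmod (z - w)) * norm u \<le> 1 / 2 * norm u"
      using 2 by (intro mult_right_mono) auto
    moreover have "(K * cmod (z - w)) * R \<le> (K * cmod (z - w)) * (R + 1)"
      using \<open>K > 0\<close> by (intro mult_left_mono) auto
    ultimately have "norm u < e"
      using 1 by linarith
    then show ?thesis by (simp add: u_def dist_norm)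
  qed
  ultimately show "\<exists>d>0. \<forall>z\<in>resolvent_set D A. dist z w < d \<longrightarrow>
      dist (resolvent D A z y) (resolvent D A w y) < e"
    by blast
qed

lemma continuous_on_resolvent_circle:
  assumes "\<And>t. \<mu> + of_real r * cis t \<in> resolvent_set D A"
  shows "continuous_on S (\<lambda>t. resolvent D A (\<mu> + of_real r * cis t) x)"
  by (rule continuous_on_compose2[OF continuous_on_resolvent[of x]])
    (use assms in \<open>auto intro!: continuous_intros\<close>)

text \<open>Isolation makes the chosen radius legitimate: its circle avoids the spectrum, and a
  continuous integrand on it is integrable. All later arguments about the projection start from
  these facts.\<close>

lemma riesz_projection_circle:
  assumes "isolated_eigenvalue D A \<mu>"
  obtains r where "r > 0" "\<And>t. \<mu> + of_real r * cis t \<in> resolvent_set D A"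
    "\<And>x. ((\<lambda>t. (- (of_real r * cis t / of_real (2 * pi))) *\<^sub>C
        resolvent D A (\<mu> + of_real r * cis t) x) has_integral riesz_projection D A \<mu> x) {0..2 * pi}"
proof -
  obtain T where T: "\<mu> \<in> spectrum D A" "open T" "T \<inter> spectrum D A = {\<mu>}"
    using assms by (auto simp: isolated_eigenvalue_def isolated_in_def)
  then obtain e where "e > 0" "cball \<mu> e \<subseteq> T"
    by (metis Int_iff insertI1 open_contains_cball)
  with T have "\<exists>r. r > 0 \<and> cball \<mu> r \<inter> spectrum D A = {\<mu>}"
    by (intro exI[of _ e]) auto
  define r where "r = (SOME r. r > 0 \<and> cball \<mu> r \<inter> spectrum D A = {\<mu>})"
  have r: "r > 0" "cball \<mu> r \<inter> spectrum D A = {\<mu>}"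
    using someI_ex[OF \<open>\<exists>r. _ r\<close>] by (auto simp: r_def)
  have circle: "\<mu> + of_real r * cis t \<in> resolvent_set D A" for t
  proof (rule ccontr)
    assume "\<mu> + of_real r * cis t \<notin> resolvent_set D A"
    then have "\<mu> + of_real r * cis t \<in> cball \<mu> r \<inter> spectrum D A"
      using r(1) by (simp add: spectrum_def dist_norm norm_mult)
    then have "of_real r * cis t = 0"
      using r(2) by simp
    then show False using r(1) by simp
  qed
  show thesis
  proof (rule that[OF r(1) circle])
    fix x
    show "((\<lambda>t. (- (of_real r * cis t / of_real (2 * pi))) *\<^sub>C
        resolvent D A (\<mu> + of_real r * cis t) x) has_integral riesz_projection D A \<mu> x) {0..2 * pi}"
      unfolding riesz_projection_def Let_def r_def[symmetric]
      by (intro integrable_integral integrable_continuous_real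
          bounded_bilinear.continuous_on[OF bounded_bilinear_scaleC]
          continuous_on_resolvent_circle circle continuous_intros) auto
  qed
qed

lemma has_integral_circle_mean:
  "((\<lambda>t. (1 / (2 * pi)) *\<^sub>R (x::'h)) has_integral x) {0..2 * pi}"
  using has_integral_const_real[of "(1 / (2 * pi)) *\<^sub>R x" 0 "2 * pi"] by simp

text \<open>On an eigenvector the resolvent is multiplication by 1 / (\<mu> - z), which cancels the
  weight and leaves a constant integrand.\<close>

lemma riesz_projection_eigenvector:
  assumes "isolated_eigenvalue D A \<mu>" "x \<in> D" "A x = \<mu> *\<^sub>C x"
  shows "riesz_projection D A \<mu> x = x"
proof -
  obtain r where r: "r > 0" "\<And>t. \<mu> + of_real r * cis t \<in> resolvent_set D A"
    and int: "\<And>x. ((\<lambda>t. (- (of_real r * cis t / of_real (2 * pi))) *\<^sub>C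
      resolvent D A (\<mu> + of_real r * cis t) x) has_integral riesz_projection D A \<mu> x) {0..2 * pi}"
    using riesz_projection_circle[OF assms(1)] by blast
  have "(- (of_real r * cis t / of_real (2 * pi))) *\<^sub>C resolvent D A (\<mu> + of_real r * cis t) x
      = (1 / (2 * pi)) *\<^sub>R x" for t
    using r(1) resolvent_eigenvector[OF r(2) assms(2,3), of t] by (simp add: scaleR_scaleC)
  then show ?thesis
    using has_integral_unique[OF int[of x], of x] has_integral_circle_mean[of x] by simp
qed

text \<open>The dual computation: paired with \<open>y\<close>, the resolvent again acts as 1 /
  (\<mu> - z), and the bounded functional passes under the integral.\<close>

lemma riesz_projection_left_eigenvector:
  assumes "isolated_eigenvalue D A \<mu>"
    and left: "\<And>x. x \<in> D \<Longrightarrow> cinner (A x) y = \<mu> * cinner x y"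
  shows "cinner (riesz_projection D A \<mu> x) y = cinner x y"
proof -
  obtain r where r: "r > 0" "\<And>t. \<mu> + of_real r * cis t \<in> resolvent_set D A"
    and int: "\<And>x. ((\<lambda>t. (- (of_real r * cis t / of_real (2 * pi))) *\<^sub>C
      resolvent D A (\<mu> + of_real r * cis t) x) has_integral riesz_projection D A \<mu> x) {0..2 * pi}"
    using riesz_projection_circle[OF assms(1)] by blast
  have "cinner ((- (of_real r * cis t / of_real (2 * pi))) *\<^sub>C
      resolvent D A (\<mu> + of_real r * cis t) x) y = cinner ((1 / (2 * pi)) *\<^sub>R x) y" for t
  proof -
    let ?z = "of_real r * cis t" and ?R = "resolvent D A (\<mu> + of_real r * cis t) x"
    have "\<mu> * cinner ?R y = cinner x y + (\<mu> + ?z) * cinner ?R y"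
      using left[OF resolvent_dom[OF r(2)[of t], of x]]
      by (simp add: resolvent_eq[OF r(2)] cinner_add_left cinner_scaleC_left)
    then have z: "- ?z * cinner ?R y = cinner x y"
      by (simp add: ring_distribs) (metis add.inverse_unique add.commute)
    have "(- (?z / of_real (2 * pi))) * cinner ?R y = (- ?z * cinner ?R y) / of_real (2 * pi)"
      by simp
    also have "\<dots> = of_real (1 / (2 * pi)) * cinner x y"
      unfolding z by simp
    finally show ?thesis
      by (simp only: cinner_scaleC_left scaleR_scaleC)
  qed
  then have "((\<lambda>t. cinner ((1 / (2 * pi)) *\<^sub>R x) y) has_integral
      cinner (riesz_projection D A \<mu> x) y) {0..2 * pi}"
    using has_integral_linear[OF int[of x] bounded_linear_cinner_left[of y]] by (simp add: o_def)
  moreover have "((\<lambda>t. cinner ((1 / (2 * pi)) *\<^sub>R x) y) has_integral cinner x y) {0..2 * pi}"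
    using has_integral_linear[OF has_integral_circle_mean[of x] bounded_linear_cinner_left[of y]]
    by (simp add: o_def)
  ultimately show ?thesis
    by (rule has_integral_unique)
qed

text \<open>With \<open>R(z)\<close> the resolvent, the vector is the reduced resolvent
  \<open>(1 / (2 \<pi> i)) \<integral> (z - \<mu>)\<^sup>-\<^sup>1 R(z) x dz\<close>. In place of \<open>(A - \<mu>) y = u\<close> one verifies the equivalent
  \<open>y = R(w) (u + (\<mu> - w) y)\<close>, because the bounded \<open>R(w)\<close> passes under the integral.\<close>

lemma riesz_projection_complement:
  assumes "isolated_eigenvalue D A \<mu>"
  shows "\<exists>y\<in>D. A y - \<mu> *\<^sub>C y = x - riesz_projection D A \<mu> x"
proof -
  obtain r where r: "r > 0" "\<And>t. \<mu> + of_real r * cis t \<in> resolvent_set D A"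
    and int: "\<And>x. ((\<lambda>t. (- (of_real r * cis t / of_real (2 * pi))) *\<^sub>C
      resolvent D A (\<mu> + of_real r * cis t) x) has_integral riesz_projection D A \<mu> x) {0..2 * pi}"
    using riesz_projection_circle[OF assms(1)] by blast
  define z where "z t = \<mu> + of_real r * cis t" for t
  define w where "w = z 0"
  have w: "w \<in> resolvent_set D A" and z: "z t \<in> resolvent_set D A" for t
    unfolding z_def w_def by (rule r(2))+
  \<comment> \<open>On the circle (z - \<mu>)^(-1) dz = i dt, so the reduced resolvent becomes the
    plain mean of the resolvent over \<open>t\<close>.\<close>
  define y where "y = integral {0..2 * pi} (\<lambda>t. (1 / (2 * pi)) *\<^sub>R resolvent D A (z t) x)"
  have y: "((\<lambda>t. (1 / (2 * pi)) *\<^sub>R resolvent D A (z t) x) has_integral y) {0..2 * pi}"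
    unfolding y_def z_def
    by (intro integrable_integral integrable_continuous_real continuous_on_scaleR
        continuous_on_resolvent_circle r continuous_intros)
  define u where "u = x - riesz_projection D A \<mu> x"
  \<comment> \<open>This integrand is chosen because the resolvent identity makes R(w) map it to the
    integrand of \<open>y\<close>. Splitting z - w into (z - \<mu>) + (\<mu> - w) evaluates its
    integral: the first part produces the Riesz projection, the second a multiple of
    \<open>y\<close>.\<close>
  have F: "((\<lambda>t. (1 / (2 * pi)) *\<^sub>R (x + (z t - w) *\<^sub>C resolvent D A (z t) x)) has_integral
      u + (\<mu> - w) *\<^sub>C y) {0..2 * pi}"
  proof -
    have eq: "(1 / (2 * pi)) *\<^sub>R (x + (z t - w) *\<^sub>C resolvent D A (z t) x) =
        (1 / (2 * pi)) *\<^sub>R x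
        - (- (of_real r * cis t / of_real (2 * pi))) *\<^sub>C resolvent D A (\<mu> + of_real r * cis t) x
        + (\<mu> - w) *\<^sub>C ((1 / (2 * pi)) *\<^sub>R resolvent D A (z t) x)" for t
    proof -
      have "(1 / (2 * pi)) *\<^sub>R (x + (z t - w) *\<^sub>C v) =
          (1 / (2 * pi)) *\<^sub>R x - (- (of_real r * cis t / of_real (2 * pi))) *\<^sub>C v
          + (\<mu> - w) *\<^sub>C ((1 / (2 * pi)) *\<^sub>R v)" for v
        unfolding scaleR_scaleC z_def
        by (simp add: scaleC_distribs add_divide_distrib diff_divide_distrib)
      from this[of "resolvent D A (z t) x"] show ?thesis by (simp add: z_def)
    qed
    show ?thesis
      unfolding eq u_def
      by (intro has_integral_add has_integral_diff has_integral_circle_mean int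
          has_integral_linear[OF y bounded_bilinear.bounded_linear_right[OF bounded_bilinear_scaleC],
            unfolded o_def])
  qed
  have "resolvent D A w ((1 / (2 * pi)) *\<^sub>R (x + (z t - w) *\<^sub>C resolvent D A (z t) x))
      = (1 / (2 * pi)) *\<^sub>R resolvent D A (z t) x" for t
  proof -
    have "resolvent D A w (x + (z t - w) *\<^sub>C resolvent D A (z t) x) = resolvent D A (z t) x"
      by (rule resolvent_unique[OF w resolvent_dom[OF z]])
        (simp add: resolvent_eq[OF z] scaleC_distribs)
    then show ?thesis
      by (simp add: linear_simps(5)[OF bounded_linear_resolvent[OF w]])
  qed
  then have "((\<lambda>t. (1 / (2 * pi)) *\<^sub>R resolvent D A (z t) x) has_integral
      resolvent D A w (u + (\<mu> - w) *\<^sub>C y)) {0..2 * pi}"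
    using has_integral_linear[OF F bounded_linear_resolvent[OF w]] by (simp add: o_def)
  then have yw: "y = resolvent D A w (u + (\<mu> - w) *\<^sub>C y)"
    using has_integral_unique y by blast
  have "y \<in> D"
    using resolvent_dom[OF w] yw by metis
  moreover have "A y = u + (\<mu> - w) *\<^sub>C y + w *\<^sub>C y"
    using resolvent_eq[OF w] yw by metis
  then have "A y - \<mu> *\<^sub>C y = u"
    by (simp add: scaleC_distribs)
  ultimately show ?thesis
    unfolding u_def by blast
qed

text \<open>The vectors orthogonal to \<open>y - z\<close> form a closed set; if it contains the
  dense \<open>D\<close>, it contains \<open>y - z\<close> itself. This makes the description in
  \<open>adjoint_op\<close> well defined.\<close>

lemma dense_cinner_eqI:
  assumes "\<And>x. x \<in> D \<Longrightarrow> cinner x y = cinner x z"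
  shows "y = z"
proof -
  have "closed {x. cinner x (y - z) = 0}"
    by (intro closed_Collect_eq linear_continuous_on bounded_linear_cinner_left continuous_on_const)
  moreover have "D \<subseteq> {x. cinner x (y - z) = 0}"
    using assms by (auto simp: cinner_diff_right)
  ultimately have "closure D \<subseteq> {x. cinner x (y - z) = 0}"
    by (rule closure_minimal[rotated])
  then have "cinner (y - z) (y - z) = 0"
    using op by (auto simp: densely_defined_closed_operator_def)
  then show ?thesis by (simp add: cinner_self)
qed

lemma adjoint_op_eq:
  assumes "y \<in> adjoint_dom D A" "x \<in> D"
  shows "cinner (A x) y = cinner x (adjoint_op D A y)"
proof -
  obtain z where z: "\<forall>x\<in>D. cinner (A x) y = cinner x z"
    using assms(1) by (auto simp: adjoint_dom_def)
  have "adjoint_op D A y = z"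
    unfolding adjoint_op_def using z by (intro the_equality) (auto intro!: dense_cinner_eqI)
  with z assms(2) show ?thesis by simp
qed

end

section \<open>The reduced equation at a simple eigenvalue\<close>

sublocale basic_assumption \<subseteq> closed_operator D A
  by unfold_locales (rule operator)

context basic_assumption
begin

abbreviation "P \<equiv> P0_proj \<psi>0 \<psi>0s"
abbreviation "Q \<equiv> Q0_proj \<psi>0 \<psi>0s"
abbreviation "S \<equiv> compressed_inverse D A \<mu>0 Q"

text \<open>The conjugate in the adjoint equation cancels against conjugate linearity in the second
  argument. This is the form in which the adjoint eigenvector is used below.\<close>

lemma left_eigenvector:
  assumes "x \<in> D"
  shows "cinner (A x) \<psi>0s = \<mu>0 * cinner x \<psi>0s"
  using adjoint_op_eq[OF \<psi>0s_dom assms] by (simp add: \<psi>0s_eigen cinner_scaleC_right)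

lemma riesz_projection_eq_P: "riesz_projection D A \<mu>0 x = P x"
proof -
  obtain B where B: "range (riesz_projection D A \<mu>0) \<subseteq> cvec.span B"
      "card B = cvec.dim (range (riesz_projection D A \<mu>0))"
    using cvec.basis_exists by blast
  then have "card B = 1"
    using simple by (simp add: algebraic_multiplicity_def)
  then obtain v where "B = {v}"
    by (auto simp: card_1_singleton_iff)
  then have mult: "\<exists>c. riesz_projection D A \<mu>0 y = c *\<^sub>C v" for y
    using B(1) by (auto simp: cvec.span_singleton)
  obtain c where c: "riesz_projection D A \<mu>0 x = c *\<^sub>C v"
    using mult by blast
  \<comment> \<open>The projection fixes \<open>\<psi>0\<close>, so \<open>\<psi>0\<close> is a
    multiple of the spanning vector, and a nonzero one since its norm is 1; it can therefore replace
    \<open>v\<close>.\<close>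
  obtain b where b: "\<psi>0 = b *\<^sub>C v"
    using mult[of \<psi>0] riesz_projection_eigenvector[OF isolated \<psi>0_dom \<psi>0_eigen] by auto
  then have "b \<noteq> 0"
    using \<psi>0_norm by auto
  then have "riesz_projection D A \<mu>0 x = (c / b) *\<^sub>C \<psi>0"
    by (simp add: b c)
  moreover have "cinner (riesz_projection D A \<mu>0 x) \<psi>0s = cinner x \<psi>0s"
    by (rule riesz_projection_left_eigenvector[OF isolated left_eigenvector])
  ultimately show ?thesis
    by (simp add: cinner_scaleC_left \<psi>0_\<psi>0s P0_proj_def)
qed

section \<open>The range of \<open>Q\<close> and the inverse of the reduced operator\<close>

lemma cinner_Q: "cinner (Q x) \<psi>0s = 0"
  by (simp add: Q0_proj_def P0_proj_def cinner_diff_left cinner_scaleC_left \<psi>0_\<psi>0s)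

lemma Q_ident: "cinner x \<psi>0s = 0 \<Longrightarrow> Q x = x"
  by (simp add: Q0_proj_def P0_proj_def)

text \<open>Turns membership in an image of \<open>Q\<close> into a linear condition that passes to
  limits; it serves for \<open>D\<close> and for every \<open>dom_pow D A m\<close>.\<close>

lemma mem_Q_image:
  assumes "cvec.subspace U" "\<psi>0 \<in> U"
  shows "x \<in> Q ` U \<longleftrightarrow> x \<in> U \<and> cinner x \<psi>0s = 0"
proof
  assume "x \<in> Q ` U"
  then show "x \<in> U \<and> cinner x \<psi>0s = 0"
    using assms cinner_Q
    by (auto simp: Q0_proj_def P0_proj_def intro!: cvec.subspace_diff cvec.subspace_scale)
qed (metis Q_ident image_eqI)

lemmas mem_Q_D = mem_Q_image[OF subspace_D \<psi>0_dom]

text \<open>The Riesz projection fixes eigenvectors and equals \<open>P\<close>, so an eigenvector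
  is its own component along \<open>\<psi>0\<close>. This gives injectivity of the reduced
  operator.\<close>

lemma eigenspace_cinner_zero:
  assumes "x \<in> D" "A x = \<mu>0 *\<^sub>C x" "cinner x \<psi>0s = 0"
  shows "x = 0"
  using riesz_projection_eigenvector[OF isolated assms(1,2)] assms(3)
  by (simp add: riesz_projection_eq_P P0_proj_def)

lemma reduced_equation_unique:
  assumes "x \<in> D" "cinner x \<psi>0s = 0" "y \<in> D" "cinner y \<psi>0s = 0"
    and "A x - \<mu>0 *\<^sub>C x = A y - \<mu>0 *\<^sub>C y"
  shows "x = y"
proof -
  have "A x - A y = \<mu>0 *\<^sub>C (x - y)"
    using assms(5) by (simp add: scaleC_distribs algebra_simps)
  then have "x - y = 0"
    using assms by (intro eigenspace_cinner_zero)
      (simp_all add: A_diff cvec.subspace_diff[OF subspace_D] cinner_diff_left)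
  then show ?thesis by simp
qed

lemma reduced_equation_solvable:
  assumes "cinner \<eta> \<psi>0s = 0"
  shows "\<exists>x\<in>D. cinner x \<psi>0s = 0 \<and> A x - \<mu>0 *\<^sub>C x = \<eta>"
proof -
  obtain y where y: "y \<in> D" "A y - \<mu>0 *\<^sub>C y = \<eta>"
    using riesz_projection_complement[OF isolated, of \<eta>] assms
    by (auto simp: riesz_projection_eq_P P0_proj_def)
  \<comment> \<open>Since \<open>\<psi>0\<close> is annihilated by A - \<mu>0, removing its
    component from \<open>y\<close> moves the solution into the range of \<open>Q\<close> without
    changing the equation.\<close>
  let ?c = "cinner y \<psi>0s"
  have "A (y - ?c *\<^sub>C \<psi>0) - \<mu>0 *\<^sub>C (y - ?c *\<^sub>C \<psi>0) = \<eta>"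
    using y by (simp add: A_diff A_scaleC \<psi>0_dom \<psi>0_eigen cvec.subspace_scale[OF subspace_D]
        scaleC_distribs mult.commute)
  moreover have "y - ?c *\<^sub>C \<psi>0 \<in> D"
    using y \<psi>0_dom by (simp add: cvec.subspace_diff[OF subspace_D] cvec.subspace_scale[OF subspace_D])
  moreover have "cinner (y - ?c *\<^sub>C \<psi>0) \<psi>0s = 0"
    by (simp add: cinner_diff_left cinner_scaleC_left \<psi>0_\<psi>0s)
  ultimately show ?thesis by blast
qed

text \<open>The left eigenvector property keeps (A - \<mu>0) x in the range of \<open>Q\<close>, so
  both copies of \<open>Q\<close> act as the identity.\<close>

lemma compressed_op_eq:
  assumes "x \<in> D" "cinner x \<psi>0s = 0"
  shows "compressed_op A \<mu>0 Q x = A x - \<mu>0 *\<^sub>C x"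
  using assms unfolding compressed_op_def
  by (simp add: Q_ident cinner_diff_left cinner_scaleC_left left_eigenvector)

lemma S_eqI:
  assumes "x \<in> D" "cinner x \<psi>0s = 0" "A x - \<mu>0 *\<^sub>C x = \<eta>"
  shows "S \<eta> = x"
  unfolding compressed_inverse_def
proof (rule inv_into_f_eq)
  show "inj_on (compressed_op A \<mu>0 Q) (Q ` D)"
    by (rule inj_onI) (metis compressed_op_eq mem_Q_D reduced_equation_unique)
qed (use assms in \<open>simp_all add: mem_Q_D compressed_op_eq\<close>)

lemma
  assumes "cinner \<eta> \<psi>0s = 0"
  shows S_dom: "S \<eta> \<in> D" and cinner_S: "cinner (S \<eta>) \<psi>0s = 0"
    and S_equation: "A (S \<eta>) - \<mu>0 *\<^sub>C S \<eta> = \<eta>"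
  using reduced_equation_solvable[OF assms] S_eqI by auto

lemma S_diff:
  assumes "cinner x \<psi>0s = 0" "cinner y \<psi>0s = 0"
  shows "S (x - y) = S x - S y"
proof (rule S_eqI)
  have "A (S x) - A (S y) - (\<mu>0 *\<^sub>C S x - \<mu>0 *\<^sub>C S y)
      = (A (S x) - \<mu>0 *\<^sub>C S x) - (A (S y) - \<mu>0 *\<^sub>C S y)"
    by simp
  also have "\<dots> = x - y"
    by (simp only: S_equation assms)
  finally show "A (S x - S y) - \<mu>0 *\<^sub>C (S x - S y) = x - y"
    using assms by (simp add: A_diff S_dom scaleC_distribs)
qed (use assms in \<open>simp_all add: S_dom cinner_S cvec.subspace_diff[OF subspace_D] cinner_diff_left\<close>)

text \<open>Regularity by bootstrapping: \<open>A x\<close> is the sum of the given right-hand side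
  and \<mu>0 x, so each power already known for \<open>x\<close> yields one more.\<close>

lemma dom_pow_SucI: "x \<in> D \<Longrightarrow> A x - \<mu>0 *\<^sub>C x \<in> dom_pow D A m \<Longrightarrow> x \<in> dom_pow D A (Suc m)"
proof (induction m)
  case (Suc m)
  then have "x \<in> dom_pow D A (Suc m)"
    using dom_pow_antimono[of m "Suc m" D A] by auto
  then have "(A x - \<mu>0 *\<^sub>C x) + \<mu>0 *\<^sub>C x \<in> dom_pow D A (Suc m)"
    using Suc.prems by (intro cvec.subspace_add cvec.subspace_scale subspace_dom_pow)
  then show ?case using Suc.prems by simp
qed simp

text \<open>This gain of one power compensates for \<open>f\<close> taking values only in
  Dom(A^(n-1)).\<close>

lemma S_dom_pow:
  assumes "cinner \<eta> \<psi>0s = 0" "\<eta> \<in> dom_pow D A (n - 1)"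
  shows "S \<eta> \<in> dom_pow D A n"
  using dom_pow_SucI[of "S \<eta>" "n - 1"] assms n_ge_1 S_dom S_equation by simp

section \<open>The projections in graph norms\<close>

lemma \<psi>0_dom_pow: "\<psi>0 \<in> dom_pow D A m"
  by (induction m) (simp_all add: \<psi>0_dom \<psi>0_eigen cvec.subspace_scale[OF subspace_dom_pow])

lemma dom_pow_n_subset_D: "dom_pow D A n \<subseteq> D"
  using n_ge_1 by (cases n) auto

lemma dom_pow_n_subset: "dom_pow D A n \<subseteq> dom_pow D A (n - 1)"
  by (rule dom_pow_antimono) simp

text \<open>Right and left eigenvector contribute the same factor \<mu>0^k, so \<open>Q\<close>
  commutes with powers of \<open>A\<close>. Hence its operator norm on the Hilbert space also bounds
  it in every graph norm.\<close>

lemma funpow_Q: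
  "x \<in> dom_pow D A m \<Longrightarrow> k \<le> m \<Longrightarrow> (A ^^ k) (Q x) = Q ((A ^^ k) x)"
proof -
  have left: "x \<in> dom_pow D A m \<Longrightarrow> k \<le> m \<Longrightarrow> cinner ((A ^^ k) x) \<psi>0s = \<mu>0 ^ k * cinner x \<psi>0s" for x
  proof (induction k arbitrary: x m)
    case (Suc k)
    then obtain l where "m = Suc l"
      by (cases m) auto
    with Suc show ?case
      by (auto simp: left_eigenvector mult.assoc simp del: funpow.simps simp add: funpow_Suc_right)
  qed simp
  have right: "(A ^^ k) \<psi>0 = \<mu>0 ^ k *\<^sub>C \<psi>0"
    by (induction k) (simp_all add: A_scaleC \<psi>0_dom \<psi>0_eigen mult.commute)
  assume "x \<in> dom_pow D A m" "k \<le> m"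
  then show ?thesis
    unfolding Q0_proj_def P0_proj_def
    by (simp add: funpow_diff_dom_pow[of _ m] funpow_scaleC_dom_pow[of _ m] \<psi>0_dom_pow left right
        cvec.subspace_scale[OF subspace_dom_pow] mult.commute)
qed

lemma Q_dom_pow: "x \<in> dom_pow D A m \<Longrightarrow> Q x \<in> dom_pow D A m"
  using mem_Q_image[OF subspace_dom_pow \<psi>0_dom_pow] by blast

lemma graph_norm_Q_le:
  assumes "x \<in> dom_pow D A m"
  shows "graph_norm A m (Q x) \<le> onorm Q * graph_norm A m x"
  unfolding graph_norm_def sum_distrib_left
  using assms
  by (intro sum_mono) (simp add: funpow_Q onorm[OF Q0_proj_bounded_linear])

text \<open>Since \<open>\<psi>0\<close> has norm 1, the modulus is the norm of \<open>P x\<close>;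
  this is how \<open>onorm P\<close> enters the bound on \<sigma>.\<close>

lemma cmod_cinner_le: "cmod (cinner x \<psi>0s) \<le> onorm P * graph_norm A m x"
proof -
  have "cmod (cinner x \<psi>0s) = norm (P x)"
    by (simp add: P0_proj_def norm_scaleC \<psi>0_norm)
  also have "\<dots> \<le> onorm P * norm x"
    by (rule onorm[OF P0_proj_bounded_linear])
  also have "\<dots> \<le> onorm P * graph_norm A m x"
    by (intro mult_left_mono norm_le_graph_norm onorm_pos_le P0_proj_bounded_linear)
  finally show ?thesis .
qed

section \<open>The perturbed problem\<close>

text \<open>\<open>\<nu>1\<close> and \<open>\<phi>1\<close> are the \<open>\<nu>\<close> and \<open>\<phi>\<close> of the theorem, and \<open>a\<close> stands for \<open>\<xi>\<close>. \<open>G\<close> is the bracket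
  in the second equation of the system, with \<open>\<epsilon> \<sigma>\<close> replaced by its value from the first one. Up to
  the factor \<open>k1\<close>, a Lipschitz constant of \<open>G\<close> is \<open>\<kappa> (2 * \<tau>)\<close> where \<open>normY (a + \<epsilon> *\<^sub>R \<phi>1) \<le> \<tau>\<close>.\<close>

definition "\<nu>1 = - cinner (f \<psi>0) \<psi>0s"
definition "\<phi>1 = S (\<nu>1 *\<^sub>C \<psi>0 + f \<psi>0)"
definition "F \<epsilon> a = f (\<psi>0 + \<epsilon> *\<^sub>R \<phi>1 + a) - f \<psi>0"
definition "G \<epsilon> a = (\<nu>1 - cinner (F \<epsilon> a) \<psi>0s) *\<^sub>C (a + \<epsilon> *\<^sub>R \<phi>1) + Q (F \<epsilon> a)"
definition "\<kappa> \<tau> = cmod \<nu>1 + k1 * L * onorm P * \<tau> + onorm Q * L"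

lemma \<psi>0_Y: "\<psi>0 \<in> Y"
  using dom_subset_Y \<psi>0_dom_pow by blast

lemma f_dom_pow: "x \<in> Y \<Longrightarrow> f x \<in> dom_pow D A (n - 1)"
  using f_range by blast

lemma dom_pow_scaleR: "x \<in> dom_pow D A m \<Longrightarrow> c *\<^sub>R x \<in> dom_pow D A m"
  by (simp add: scaleR_scaleC cvec.subspace_scale[OF subspace_dom_pow])

lemma cinner_scaleR_left: "cinner (c *\<^sub>R x) (y::'h) = of_real c * cinner x y"
  by (simp add: scaleR_scaleC cinner_scaleC_left)

lemma onorm_P_nonneg: "0 \<le> onorm P" and onorm_Q_nonneg: "0 \<le> onorm Q"
  by (intro onorm_pos_le P0_proj_bounded_linear Q0_proj_bounded_linear)+

lemma cinner_first_order_rhs: "cinner (\<nu>1 *\<^sub>C \<psi>0 + f \<psi>0) \<psi>0s = 0"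
  by (simp add: \<nu>1_def cinner_add_left cinner_diff_left cinner_scaleC_left \<psi>0_\<psi>0s)

lemma \<phi>1_dom_pow: "\<phi>1 \<in> dom_pow D A n"
  unfolding \<phi>1_def
  by (intro S_dom_pow cinner_first_order_rhs cvec.subspace_add cvec.subspace_scale
      subspace_dom_pow \<psi>0_dom_pow f_dom_pow \<psi>0_Y)

lemma \<phi>1_D: "\<phi>1 \<in> D" and \<phi>1_Y: "\<phi>1 \<in> Y"
  using \<phi>1_dom_pow dom_pow_n_subset_D dom_subset_Y by auto

lemma cinner_\<phi>1: "cinner \<phi>1 \<psi>0s = 0"
  unfolding \<phi>1_def by (rule cinner_S[OF cinner_first_order_rhs])

lemma \<phi>1_equation: "A \<phi>1 - \<mu>0 *\<^sub>C \<phi>1 = \<nu>1 *\<^sub>C \<psi>0 + f \<psi>0"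
  unfolding \<phi>1_def by (rule S_equation[OF cinner_first_order_rhs])

lemma first_order_unique:
  assumes "\<phi> \<in> Q ` D"
  shows "A \<phi> - \<mu>0 *\<^sub>C \<phi> = \<nu>1 *\<^sub>C \<psi>0 + f \<psi>0 \<longleftrightarrow> \<phi> = \<phi>1"
  using assms reduced_equation_unique[of \<phi> \<phi>1]
  by (auto simp: mem_Q_D \<phi>1_equation \<phi>1_D cinner_\<phi>1)

section \<open>The norm of \<open>Y\<close>, and the system as a fixed point equation\<close>

lemma normY_nonneg: "x \<in> Y \<Longrightarrow> 0 \<le> normY x"
  and normY_eq_0: "x \<in> Y \<Longrightarrow> normY x = 0 \<longleftrightarrow> x = 0"
  and normY_triangle: "x \<in> Y \<Longrightarrow> y \<in> Y \<Longrightarrow> normY (x + y) \<le> normY x + normY y"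
  using Y_banach by (auto simp: banach_subspace_def)

lemma normY_scaleR: "x \<in> Y \<Longrightarrow> normY (c *\<^sub>R x) = \<bar>c\<bar> * normY x"
  using Y_banach by (simp add: banach_subspace_def scaleR_scaleC)

lemma graph_norm_le_normY: "x \<in> dom_pow D A n \<Longrightarrow> graph_norm A (n - 1) x \<le> k1 * normY x"
  and normY_le_graph_norm: "x \<in> dom_pow D A n \<Longrightarrow> normY x \<le> k2 / k1 * graph_norm A n x"
  using norm_bounds k1_pos by (auto simp: field_simps)

lemma cinner_G:
  assumes "cinner a \<psi>0s = 0"
  shows "cinner (G \<epsilon> a) \<psi>0s = 0"
  using assms
  by (simp add: G_def cinner_add_left cinner_scaleC_left cinner_scaleR_left cinner_\<phi>1 cinner_Q)

lemma F_dom_pow: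
  assumes "\<psi>0 + \<epsilon> *\<^sub>R \<phi>1 + a \<in> Y"
  shows "F \<epsilon> a \<in> dom_pow D A (n - 1)"
  unfolding F_def
  using assms by (intro cvec.subspace_diff subspace_dom_pow f_dom_pow \<psi>0_Y)

lemma G_dom_pow:
  assumes "a \<in> dom_pow D A (n - 1)" "\<psi>0 + \<epsilon> *\<^sub>R \<phi>1 + a \<in> Y"
  shows "G \<epsilon> a \<in> dom_pow D A (n - 1)"
  unfolding G_def
  by (intro cvec.subspace_add cvec.subspace_scale subspace_dom_pow dom_pow_scaleR Q_dom_pow
      F_dom_pow[OF assms(2)] assms(1) subsetD[OF dom_pow_n_subset \<phi>1_dom_pow])

lemma \<psi>_Y:
  assumes "a \<in> dom_pow D A n"
  shows "\<psi>0 + \<epsilon> *\<^sub>R \<phi>1 + a \<in> Y"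
  using assms \<psi>0_dom_pow \<phi>1_dom_pow dom_subset_Y
  by (metis cvec.subspace_add dom_pow_scaleR subsetD subspace_dom_pow)

text \<open>A solution is a priori only in \<open>D\<close>, with \<psi> in \<open>Y\<close>. The
  second equation places its image under A - \<mu>0 in Dom(A^(n-1)), and the gain of
  \<open>S\<close> raises it to Dom(A^n). Uniqueness among all solutions thus reduces to uniqueness
  of fixed points there.\<close>

lemma solves_system_iff:
  "solves_system D A Y f \<mu>0 \<psi>0 \<psi>0s \<nu>1 \<phi>1 \<epsilon> \<sigma> \<xi> \<longleftrightarrow>
    \<xi> \<in> dom_pow D A n \<and> cinner \<xi> \<psi>0s = 0 \<and> S (\<epsilon> *\<^sub>R G \<epsilon> \<xi>) = \<xi> \<and>
    of_real \<epsilon> * \<sigma> = - cinner (F \<epsilon> \<xi>) \<psi>0s" (is "?l = ?r")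
proof
  assume ?l
  then have \<xi>: "\<xi> \<in> D" "cinner \<xi> \<psi>0s = 0" and Y: "\<psi>0 + \<epsilon> *\<^sub>R \<phi>1 + \<xi> \<in> Y"
    and \<sigma>: "of_real \<epsilon> * \<sigma> + cinner (F \<epsilon> \<xi>) \<psi>0s = 0"
    and eq: "compressed_op A \<mu>0 Q \<xi> =
      \<epsilon> *\<^sub>R ((\<nu>1 + of_real \<epsilon> * \<sigma>) *\<^sub>C (\<xi> + \<epsilon> *\<^sub>R \<phi>1) + Q (F \<epsilon> \<xi>))"
    by (auto simp: solves_system_def mem_Q_D F_def Let_def)
  have \<sigma>': "of_real \<epsilon> * \<sigma> = - cinner (F \<epsilon> \<xi>) \<psi>0s"
    using \<sigma> by (simp add: eq_neg_iff_add_eq_0)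
  \<comment> \<open>The inclusion of \<open>Y\<close> in Dom(A^(n-1)) applies to \<psi>; subtracting
    this smooth part transfers it to \<open>\<xi>\<close>.\<close>
  have "\<psi>0 + \<epsilon> *\<^sub>R \<phi>1 \<in> dom_pow D A (n - 1)"
    by (intro cvec.subspace_add subspace_dom_pow \<psi>0_dom_pow dom_pow_scaleR
        subsetD[OF dom_pow_n_subset \<phi>1_dom_pow])
  then have "(\<psi>0 + \<epsilon> *\<^sub>R \<phi>1 + \<xi>) - (\<psi>0 + \<epsilon> *\<^sub>R \<phi>1) \<in> dom_pow D A (n - 1)"
    using Y Y_subset_dom cvec.subspace_diff[OF subspace_dom_pow] by blast
  then have G: "\<epsilon> *\<^sub>R G \<epsilon> \<xi> \<in> dom_pow D A (n - 1)"
    using G_dom_pow[OF _ Y] by (simp add: dom_pow_scaleR)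
  have "A \<xi> - \<mu>0 *\<^sub>C \<xi> = \<epsilon> *\<^sub>R G \<epsilon> \<xi>"
    using eq unfolding compressed_op_eq[OF \<xi>] \<sigma>' G_def by simp
  then have "S (\<epsilon> *\<^sub>R G \<epsilon> \<xi>) = \<xi>"
    by (rule S_eqI[OF \<xi>])
  moreover have "S (\<epsilon> *\<^sub>R G \<epsilon> \<xi>) \<in> dom_pow D A n"
    using \<xi> by (intro S_dom_pow G) (simp add: cinner_scaleR_left cinner_G)
  ultimately show ?r
    using \<xi> \<sigma>' by simp
next
  assume r: ?r
  then have \<xi>: "\<xi> \<in> D" "cinner \<xi> \<psi>0s = 0"
    using dom_pow_n_subset_D by auto
  have "compressed_op A \<mu>0 Q \<xi> = \<epsilon> *\<^sub>R G \<epsilon> \<xi>"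
    using S_equation[of "\<epsilon> *\<^sub>R G \<epsilon> \<xi>"] r
    by (simp add: compressed_op_eq[OF \<xi>] cinner_scaleR_left cinner_G)
  then show ?l
    using r \<xi> \<psi>_Y[of \<xi> \<epsilon>]
    by (simp add: solves_system_def Let_def mem_Q_D F_def[symmetric] G_def)
qed

text \<open>Pairing the eigenvalue equation with \<open>\<psi>0s\<close> determines \<mu>;
  subtracting \<epsilon> times the first-order equation leaves the equation for the
  corrector.\<close>

lemma decomposition:
  assumes \<psi>: "\<psi> \<in> D" "\<psi> \<in> Y" and eq: "(A \<psi> - \<mu> *\<^sub>C \<psi>) - \<epsilon> *\<^sub>R f \<psi> = 0"
    and normalized: "cinner \<psi> \<psi>0s = 1"
  shows "\<exists>\<sigma> \<xi>. \<mu> = \<mu>0 + of_real \<epsilon> * \<nu>1 + of_real (\<epsilon>\<^sup>2) * \<sigma> \<and> \<psi> = \<psi>0 + \<epsilon> *\<^sub>R \<phi>1 + \<xi> \<and>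
    \<xi> \<in> Q ` D \<and> solves_system D A Y f \<mu>0 \<psi>0 \<psi>0s \<nu>1 \<phi>1 \<epsilon> \<sigma> \<xi>"
proof -
  define \<xi> where "\<xi> = \<psi> - \<psi>0 - \<epsilon> *\<^sub>R \<phi>1"
  have \<psi>_eq: "\<psi> = \<psi>0 + \<epsilon> *\<^sub>R \<phi>1 + \<xi>"
    by (simp add: \<xi>_def)
  have D: "\<epsilon> *\<^sub>R \<phi>1 \<in> D" "\<psi> - \<psi>0 \<in> D"
    using \<phi>1_D \<psi> \<psi>0_dom
    by (simp_all add: scaleR_scaleC cvec.subspace_scale[OF subspace_D] cvec.subspace_diff[OF subspace_D])
  have \<xi>: "\<xi> \<in> D" "cinner \<xi> \<psi>0s = 0"
    using D unfolding \<xi>_def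
    by (simp_all add: cvec.subspace_diff[OF subspace_D] cinner_diff_left cinner_scaleR_left
        cinner_\<phi>1 normalized \<psi>0_\<psi>0s)
  have F: "F \<epsilon> \<xi> = f \<psi> - f \<psi>0"
    by (simp add: F_def \<psi>_eq[symmetric])
  have A\<psi>: "A \<psi> = \<mu> *\<^sub>C \<psi> + \<epsilon> *\<^sub>R f \<psi>"
    using eq by (simp add: algebra_simps)
  have "\<mu>0 = \<mu> + of_real \<epsilon> * cinner (f \<psi>) \<psi>0s"
    using left_eigenvector[OF \<psi>(1)]
    by (simp add: A\<psi> cinner_add_left cinner_scaleC_left cinner_scaleR_left normalized)
  then have "\<mu> - \<mu>0 = of_real \<epsilon> * (- cinner (f \<psi>) \<psi>0s)"
    by simp
  also have "- cinner (f \<psi>) \<psi>0s = \<nu>1 - cinner (F \<epsilon> \<xi>) \<psi>0s"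
    by (simp add: F \<nu>1_def cinner_diff_left)
  finally have \<mu>: "\<mu> - \<mu>0 = of_real \<epsilon> * (\<nu>1 - cinner (F \<epsilon> \<xi>) \<psi>0s)" .
  have "\<exists>\<sigma>. of_real \<epsilon> * \<sigma> = - cinner (F \<epsilon> \<xi>) \<psi>0s"
  proof (cases "\<epsilon> = 0")
    \<comment> \<open>No division by \<epsilon> is possible here. But \<mu> = \<mu>0, and simplicity
      with the normalization forces \<psi> = \<open>\<psi>0\<close>, so the right-hand side vanishes
      and 0 can serve as \<sigma>.\<close>
    case True
    have "\<psi> - \<psi>0 = 0"
      using True \<mu> D
      by (intro eigenspace_cinner_zero)
        (simp_all add: A_diff \<psi> \<psi>0_dom A\<psi> \<psi>0_eigen scaleC_distribs cinner_diff_left normalized \<psi>0_\<psi>0s)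
    then show ?thesis
      by (intro exI[of _ 0]) (simp add: F)
  next
    case False
    then show ?thesis
      by (intro exI[of _ "- cinner (F \<epsilon> \<xi>) \<psi>0s / of_real \<epsilon>"]) simp
  qed
  then obtain \<sigma> where \<sigma>: "of_real \<epsilon> * \<sigma> = - cinner (F \<epsilon> \<xi>) \<psi>0s" by blast
  have "\<mu> = \<mu>0 + of_real \<epsilon> * (\<nu>1 + of_real \<epsilon> * \<sigma>)"
    using \<mu> unfolding \<sigma> by (simp add: algebra_simps)
  then have "\<mu> = \<mu>0 + of_real \<epsilon> * \<nu>1 + of_real (\<epsilon>\<^sup>2) * \<sigma>"
    by (simp add: algebra_simps power2_eq_square)
  moreover have "A \<xi> - \<mu>0 *\<^sub>C \<xi> = \<epsilon> *\<^sub>R G \<epsilon> \<xi>"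
  proof -
    \<comment> \<open>The quotient of \<mu> - \<mu>0 by \<epsilon>, written so that it is meaningful
      at \<epsilon> = 0.\<close>
    define c where "c = \<nu>1 - cinner (F \<epsilon> \<xi>) \<psi>0s"
    have "A \<xi> - \<mu>0 *\<^sub>C \<xi> = (A \<psi> - \<mu>0 *\<^sub>C \<psi>) - \<epsilon> *\<^sub>R (A \<phi>1 - \<mu>0 *\<^sub>C \<phi>1)"
      unfolding \<xi>_def using D \<psi> \<psi>0_dom \<phi>1_D
      by (simp add: A_diff A_scaleC \<psi>0_eigen scaleC_distribs scaleR_diff_right scaleR_scaleC mult.commute)
    also have "A \<psi> - \<mu>0 *\<^sub>C \<psi> = (\<mu> - \<mu>0) *\<^sub>C \<psi> + \<epsilon> *\<^sub>R f \<psi>"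
      by (simp add: A\<psi> scaleC_distribs)
    also have "(\<mu> - \<mu>0) *\<^sub>C \<psi> = \<epsilon> *\<^sub>R (c *\<^sub>C \<psi>)"
      unfolding \<mu> c_def[symmetric] by (simp add: scaleR_scaleC)
    finally have "A \<xi> - \<mu>0 *\<^sub>C \<xi> = \<epsilon> *\<^sub>R (c *\<^sub>C \<psi> - \<nu>1 *\<^sub>C \<psi>0 + F \<epsilon> \<xi>)"
      by (simp add: \<phi>1_equation F algebra_simps)
    also have "c *\<^sub>C \<psi> = c *\<^sub>C \<psi>0 + c *\<^sub>C (\<xi> + \<epsilon> *\<^sub>R \<phi>1)"
      by (subst \<psi>_eq) (simp add: scaleC_distribs)
    \<comment> \<open>The term with \<open>\<nu>1\<close> cancels the first-order equation, and the
      remaining \<open>- P (F \<epsilon> \<xi>)\<close> turns \<open>F \<epsilon> \<xi>\<close> into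
      its \<open>Q\<close>-part.\<close>
    also have "c *\<^sub>C \<psi>0 = \<nu>1 *\<^sub>C \<psi>0 - P (F \<epsilon> \<xi>)"
      by (simp add: c_def scaleC_distribs P0_proj_def)
    also have "\<nu>1 *\<^sub>C \<psi>0 - P (F \<epsilon> \<xi>) + c *\<^sub>C (\<xi> + \<epsilon> *\<^sub>R \<phi>1) - \<nu>1 *\<^sub>C \<psi>0 + F \<epsilon> \<xi> = G \<epsilon> \<xi>"
      by (simp add: G_def Q0_proj_def c_def[symmetric])
    finally show ?thesis .
  qed
  then have "solves_system D A Y f \<mu>0 \<psi>0 \<psi>0s \<nu>1 \<phi>1 \<epsilon> \<sigma> \<xi>"
    using \<xi> \<sigma> \<psi>(2) unfolding solves_system_def Let_def \<psi>_eq[symmetric] F[symmetric]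
    by (simp add: mem_Q_D compressed_op_eq[OF \<xi>] G_def)
  ultimately show ?thesis
    using \<psi>_eq \<xi> mem_Q_D by blast
qed

section \<open>Lipschitz estimates for \<open>F\<close> and \<open>G\<close>\<close>

lemma F_diff_le:
  assumes "a \<in> dom_pow D A n" "b \<in> dom_pow D A n"
    and "normY (a + \<epsilon> *\<^sub>R \<phi>1) < rL" "normY (b + \<epsilon> *\<^sub>R \<phi>1) < rL"
  shows "graph_norm A (n - 1) (F \<epsilon> a - F \<epsilon> b) \<le> k1 * L * normY (a - b)"
  using f_lipschitz[rule_format, OF \<psi>_Y[OF assms(1), of \<epsilon>] \<psi>_Y[OF assms(2), of \<epsilon>]] assms(3,4)
  by (simp add: F_def add.commute add.assoc)

lemma F_le:
  assumes "a \<in> dom_pow D A n" "normY (a + \<epsilon> *\<^sub>R \<phi>1) < rL"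
  shows "graph_norm A (n - 1) (F \<epsilon> a) \<le> k1 * L * normY (a + \<epsilon> *\<^sub>R \<phi>1)"
proof -
  have "normY 0 = 0"
    using normY_scaleR[OF \<psi>0_Y, of 0] by simp
  then show ?thesis
    using f_lipschitz[rule_format, OF \<psi>_Y[OF assms(1), of \<epsilon>] \<psi>0_Y] assms(2) rL_pos
    by (simp add: F_def add.commute add.assoc)
qed

lemma cinner_F_le:
  assumes "a \<in> dom_pow D A n" "normY (a + \<epsilon> *\<^sub>R \<phi>1) \<le> \<tau>" "\<tau> < rL"
  shows "cmod (cinner (F \<epsilon> a) \<psi>0s) \<le> k1 * L * onorm P * \<tau>"
proof -
  have "cmod (cinner (F \<epsilon> a) \<psi>0s) \<le> onorm P * graph_norm A (n - 1) (F \<epsilon> a)"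
    by (rule cmod_cinner_le)
  also have "\<dots> \<le> onorm P * (k1 * L * normY (a + \<epsilon> *\<^sub>R \<phi>1))"
    using assms by (intro mult_left_mono F_le onorm_P_nonneg) auto
  also have "\<dots> \<le> onorm P * (k1 * L * \<tau>)"
    using assms k1_pos L_pos by (intro mult_left_mono onorm_P_nonneg) auto
  finally show ?thesis by (simp add: mult_ac)
qed

lemma shift_dom_pow: "a \<in> dom_pow D A n \<Longrightarrow> a + \<epsilon> *\<^sub>R \<phi>1 \<in> dom_pow D A n"
  by (intro cvec.subspace_add subspace_dom_pow dom_pow_scaleR \<phi>1_dom_pow)

text \<open>The common estimate behind the size and the Lipschitz bound of \<open>G\<close>:
  \<open>x\<close> and \<open>y\<close> are the shifted point and \<open>F\<close> in one case,
  differences of points and of \<open>F\<close> in the other.\<close>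

lemma graph_norm_combination_le:
  assumes "x \<in> dom_pow D A n" "y \<in> dom_pow D A (n - 1)"
    and "normY x \<le> s" "graph_norm A (n - 1) y \<le> k1 * L * s" "cmod c \<le> b"
  shows "graph_norm A (n - 1) (c *\<^sub>C x + Q y) \<le> k1 * (b + onorm Q * L) * s"
proof -
  have x: "x \<in> dom_pow D A (n - 1)"
    using assms(1) dom_pow_n_subset by blast
  have "graph_norm A (n - 1) (c *\<^sub>C x + Q y) \<le> cmod c * graph_norm A (n - 1) x + graph_norm A (n - 1) (Q y)"
    using graph_norm_add_le[of "c *\<^sub>C x" "n - 1" "Q y"] x assms(2)
    by (simp add: graph_norm_scaleC Q_dom_pow cvec.subspace_scale[OF subspace_dom_pow])
  also have "\<dots> \<le> b * (k1 * s) + onorm Q * (k1 * L * s)"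
  proof (intro add_mono mult_mono)
    show "graph_norm A (n - 1) x \<le> k1 * s"
      using graph_norm_le_normY[OF assms(1)] assms(3) k1_pos
      by (meson mult_left_mono order.strict_implies_order order_trans)
    show "graph_norm A (n - 1) (Q y) \<le> onorm Q * (k1 * L * s)"
      using graph_norm_Q_le[OF assms(2)] mult_left_mono[OF assms(4) onorm_Q_nonneg] by linarith
    show "0 \<le> b" using assms(5) norm_ge_zero[of c] by linarith
  qed (use assms graph_norm_nonneg in auto)
  finally show ?thesis by (simp add: algebra_simps)
qed

lemma G_le:
  assumes a: "a \<in> dom_pow D A n" "normY (a + \<epsilon> *\<^sub>R \<phi>1) \<le> \<tau>" and \<tau>: "\<tau> < rL"
  shows "graph_norm A (n - 1) (G \<epsilon> a) \<le> k1 * \<kappa> \<tau> * \<tau>"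
  unfolding G_def \<kappa>_def
proof (rule graph_norm_combination_le[OF shift_dom_pow[OF a(1)] F_dom_pow[OF \<psi>_Y[OF a(1)]] a(2)])
  have "k1 * L * normY (a + \<epsilon> *\<^sub>R \<phi>1) \<le> k1 * L * \<tau>"
    using a(2) k1_pos L_pos by simp
  then show "graph_norm A (n - 1) (F \<epsilon> a) \<le> k1 * L * \<tau>"
    using F_le[OF a(1), of \<epsilon>] a(2) \<tau> by linarith
  show "cmod (\<nu>1 - cinner (F \<epsilon> a) \<psi>0s) \<le> cmod \<nu>1 + k1 * L * onorm P * \<tau>"
    using norm_triangle_ineq4[of \<nu>1 "cinner (F \<epsilon> a) \<psi>0s"] cinner_F_le[OF a \<tau>] by linarith
qed

lemma G_diff_le:
  assumes a: "a \<in> dom_pow D A n" "normY (a + \<epsilon> *\<^sub>R \<phi>1) \<le> \<tau>"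
    and b: "b \<in> dom_pow D A n" "normY (b + \<epsilon> *\<^sub>R \<phi>1) \<le> \<tau>" and \<tau>: "\<tau> < rL"
  shows "graph_norm A (n - 1) (G \<epsilon> a - G \<epsilon> b) \<le> k1 * \<kappa> (2 * \<tau>) * normY (a - b)"
proof -
  let ?p = "k1 * L * onorm P"
  let ?ca = "cinner (F \<epsilon> a) \<psi>0s" and ?cb = "cinner (F \<epsilon> b) \<psi>0s"
  \<comment> \<open>The usual splitting of a difference of products. The change of the scalar
    coefficient in \<open>?v\<close> contributes a second \<open>?p * \<tau>\<close>, whence the
    argument \<open>2 * \<tau>\<close> of \<open>\<kappa>\<close>.\<close>
  let ?u = "(\<nu>1 - ?ca) *\<^sub>C (a - b) + Q (F \<epsilon> a - F \<epsilon> b)" and ?v = "(?cb - ?ca) *\<^sub>C (b + \<epsilon> *\<^sub>R \<phi>1)"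
  have ab: "a - b \<in> dom_pow D A n"
    by (intro cvec.subspace_diff subspace_dom_pow a b)
  have F: "F \<epsilon> a - F \<epsilon> b \<in> dom_pow D A (n - 1)"
    by (intro cvec.subspace_diff subspace_dom_pow F_dom_pow \<psi>_Y a b)
  have F_le: "graph_norm A (n - 1) (F \<epsilon> a - F \<epsilon> b) \<le> k1 * L * normY (a - b)"
    using F_diff_le[OF a(1) b(1), of \<epsilon>] a(2) b(2) \<tau> by linarith
  have split: "G \<epsilon> a - G \<epsilon> b = ?u + ?v"
    by (simp add: G_def scaleC_distribs linear_simps(2)[OF Q0_proj_bounded_linear])
  have "graph_norm A (n - 1) (?u + ?v) \<le> graph_norm A (n - 1) ?u + graph_norm A (n - 1) ?v"
  proof (rule graph_norm_add_le)
    show "?u \<in> dom_pow D A (n - 1)"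
      by (intro cvec.subspace_add cvec.subspace_scale subspace_dom_pow Q_dom_pow F
          subsetD[OF dom_pow_n_subset ab])
    show "?v \<in> dom_pow D A (n - 1)"
      by (intro cvec.subspace_scale subspace_dom_pow
          subsetD[OF dom_pow_n_subset shift_dom_pow[OF b(1)]])
  qed
  moreover have "graph_norm A (n - 1) ?u \<le> k1 * ((cmod \<nu>1 + ?p * \<tau>) + onorm Q * L) * normY (a - b)"
  proof (rule graph_norm_combination_le[OF ab F order_refl F_le])
    show "cmod (\<nu>1 - ?ca) \<le> cmod \<nu>1 + ?p * \<tau>"
      using norm_triangle_ineq4[of \<nu>1 ?ca] cinner_F_le[OF a \<tau>] by linarith
  qed
  moreover have "graph_norm A (n - 1) ?v \<le> (?p * normY (a - b)) * (k1 * \<tau>)"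
  proof -
    have "cmod (?cb - ?ca) = cmod (cinner (F \<epsilon> a - F \<epsilon> b) \<psi>0s)"
      by (simp add: cinner_diff_left norm_minus_commute)
    also have "\<dots> \<le> onorm P * (k1 * L * normY (a - b))"
      using cmod_cinner_le[of "F \<epsilon> a - F \<epsilon> b" "n - 1"] mult_left_mono[OF F_le onorm_P_nonneg] by linarith
    finally have 1: "cmod (?cb - ?ca) \<le> ?p * normY (a - b)"
      by (simp add: mult_ac)
    have 2: "graph_norm A (n - 1) (b + \<epsilon> *\<^sub>R \<phi>1) \<le> k1 * \<tau>"
      using graph_norm_le_normY[OF shift_dom_pow[OF b(1)]] b(2) k1_pos
      by (meson mult_left_mono order.strict_implies_order order_trans)
    have "graph_norm A (n - 1) ?v = cmod (?cb - ?ca) * graph_norm A (n - 1) (b + \<epsilon> *\<^sub>R \<phi>1)"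
      using shift_dom_pow[OF b(1), of \<epsilon>] dom_pow_n_subset by (intro graph_norm_scaleC) auto
    also have "\<dots> \<le> (?p * normY (a - b)) * (k1 * \<tau>)"
      by (intro mult_mono 1 2 graph_norm_nonneg order_trans[OF norm_ge_zero 1])
    finally show ?thesis .
  qed
  ultimately have "graph_norm A (n - 1) (G \<epsilon> a - G \<epsilon> b)
      \<le> k1 * ((cmod \<nu>1 + ?p * \<tau>) + onorm Q * L) * normY (a - b) + (?p * normY (a - b)) * (k1 * \<tau>)"
    unfolding split by linarith
  also have "\<dots> = k1 * \<kappa> (2 * \<tau>) * normY (a - b)"
    by (simp add: \<kappa>_def algebra_simps)
  finally show ?thesis .
qed

text \<open>The metric is that of \<open>dom_pow D A n\<close>, not that of \<open>Y\<close>: the bound of \<open>graph_norm A (n - 1)\<close>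
  by \<open>normY\<close> is available on \<open>dom_pow D A n\<close> only.\<close>

lemma ex1_fixed_point:
  assumes C: "C > 0" "\<And>\<eta>. \<eta> \<in> Q ` dom_pow D A (n - 1) \<Longrightarrow>
        graph_norm A n (S \<eta>) \<le> C * graph_norm A (n - 1) \<eta>"
    and r: "0 \<le> r" and \<tau>_def: "\<tau> = \<bar>\<epsilon>\<bar> * normY \<phi>1 + r" and \<tau>: "\<tau> < rL"
    and contraction: "k2 * C * \<bar>\<epsilon>\<bar> * \<kappa> (2 * \<tau>) < 1"
    and invariance: "k2 * C * \<bar>\<epsilon>\<bar> * \<kappa> \<tau> * \<tau> \<le> r"
  shows "\<exists>!a. a \<in> dom_pow D A n \<and> cinner a \<psi>0s = 0 \<and> normY a \<le> r \<and> S (\<epsilon> *\<^sub>R G \<epsilon> a) = a"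
proof -
  \<comment> \<open>The ball is taken in \<open>normY\<close> although the metric is the graph
    metric; it is still closed there because \<open>k2 / k1\<close> times the graph norm bounds
    \<open>normY\<close>.\<close>
  define M where "M = {a \<in> dom_pow D A n. cinner a \<psi>0s = 0 \<and> normY a \<le> r}"
  define T where "T a = S (\<epsilon> *\<^sub>R G \<epsilon> a)" for a
  define q where "q = k2 * C * \<bar>\<epsilon>\<bar> * \<kappa> (2 * \<tau>)"
  have Y: "a \<in> Y" if "a \<in> dom_pow D A n" for a
    using that dom_subset_Y by blast
  have M_\<tau>: "normY (a + \<epsilon> *\<^sub>R \<phi>1) \<le> \<tau>" if "a \<in> M" for a
    using that normY_triangle[OF Y Y[OF dom_pow_scaleR[OF \<phi>1_dom_pow]], of a \<epsilon>]
    by (simp add: M_def \<tau>_def normY_scaleR \<phi>1_Y)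
  have G0: "cinner (\<epsilon> *\<^sub>R G \<epsilon> a) \<psi>0s = 0" and G_dom: "G \<epsilon> a \<in> dom_pow D A (n - 1)" if "a \<in> M" for a
    using that dom_pow_n_subset G_dom_pow[of a \<epsilon>] \<psi>_Y[of a \<epsilon>]
    by (auto simp: M_def cinner_scaleR_left cinner_G)
  have S_le: "graph_norm A n (S (\<epsilon> *\<^sub>R \<eta>)) \<le> C * \<bar>\<epsilon>\<bar> * graph_norm A (n - 1) \<eta>"
    if "cinner (\<epsilon> *\<^sub>R \<eta>) \<psi>0s = 0" "\<eta> \<in> dom_pow D A (n - 1)" for \<eta>
    using C(2)[of "\<epsilon> *\<^sub>R \<eta>"] that
    by (simp add: mem_Q_image[OF subspace_dom_pow \<psi>0_dom_pow] dom_pow_scaleR graph_norm_scaleR mult.assoc)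
  have T_M: "T a \<in> M" if a: "a \<in> M" for a
  proof -
    have an: "a \<in> dom_pow D A n" using a by (simp add: M_def)
    have Tn: "T a \<in> dom_pow D A n"
      unfolding T_def by (intro S_dom_pow G0 a dom_pow_scaleR G_dom)
    have "normY (T a) \<le> k2 / k1 * graph_norm A n (T a)"
      by (rule normY_le_graph_norm[OF Tn])
    also have "\<dots> \<le> k2 / k1 * (C * \<bar>\<epsilon>\<bar> * graph_norm A (n - 1) (G \<epsilon> a))"
      unfolding T_def using k1_pos k2_pos by (intro mult_left_mono S_le G0 G_dom a) auto
    also have "\<dots> \<le> k2 / k1 * (C * \<bar>\<epsilon>\<bar> * (k1 * \<kappa> \<tau> * \<tau>))"
      using k1_pos k2_pos C(1) by (intro mult_left_mono G_le an M_\<tau> a \<tau>) auto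
    \<comment> \<open>The \<open>k1\<close> from the bound on \<open>G\<close> cancels against
      \<open>k2 / k1\<close>, which is why \<open>k1\<close> is absent from the threshold for
      \<open>r2\<close>.\<close>
    also have "\<dots> = k2 * C * \<bar>\<epsilon>\<bar> * \<kappa> \<tau> * \<tau>"
      using k1_pos by simp
    finally have "normY (T a) \<le> r" using invariance by linarith
    then show ?thesis
      using Tn cinner_S[OF G0[OF a]] by (simp add: M_def T_def)
  qed
  have T_contraction: "graph_dist A n (T a) (T b) \<le> q * graph_dist A n a b"
    if a: "a \<in> M" and b: "b \<in> M" for a b
  proof -
    have abn: "a \<in> dom_pow D A n" "b \<in> dom_pow D A n" using a b by (auto simp: M_def)
    have \<kappa>: "0 \<le> \<kappa> (2 * \<tau>)"
      using r normY_nonneg[OF \<phi>1_Y] onorm_P_nonneg onorm_Q_nonneg k1_pos L_pos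
      by (auto simp: \<kappa>_def \<tau>_def)
    have "graph_dist A n (T a) (T b) = graph_norm A n (T a - T b)"
      using T_M[OF a] T_M[OF b] by (simp add: graph_norm_diff M_def)
    also have "T a - T b = S (\<epsilon> *\<^sub>R (G \<epsilon> a - G \<epsilon> b))"
      by (simp add: T_def scaleR_diff_right S_diff[OF G0[OF a] G0[OF b]])
    also have "graph_norm A n \<dots> \<le> C * \<bar>\<epsilon>\<bar> * graph_norm A (n - 1) (G \<epsilon> a - G \<epsilon> b)"
      using G0[OF a] G0[OF b] G_dom[OF a] G_dom[OF b]
      by (intro S_le cvec.subspace_diff subspace_dom_pow) (simp_all add: scaleR_diff_right cinner_diff_left)
    also have "\<dots> \<le> C * \<bar>\<epsilon>\<bar> * (k1 * \<kappa> (2 * \<tau>) * normY (a - b))"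
      using C(1) by (intro mult_left_mono G_diff_le abn M_\<tau> a b \<tau>) auto
    \<comment> \<open>Returning from \<open>normY\<close> to the graph norm of order n closes the
      contraction estimate in a single metric.\<close>
    also have "\<dots> \<le> C * \<bar>\<epsilon>\<bar> * (k1 * \<kappa> (2 * \<tau>) * (k2 / k1 * graph_norm A n (a - b)))"
      using C(1) k1_pos \<kappa> abn
      by (intro mult_left_mono normY_le_graph_norm cvec.subspace_diff subspace_dom_pow) auto
    also have "\<dots> = q * graph_dist A n a b"
      using k1_pos abn by (simp add: q_def graph_norm_diff)
    finally show ?thesis .
  qed
  interpret Metric_space M "graph_dist A n"
    by (rule Metric_space_graph_dist)
  have "mcomplete"
    unfolding mcomplete_def
  proof (intro allI impI)
    fix X assume X: "MCauchy X"
    then have XM: "X j \<in> M" for j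
      by (auto simp: MCauchy_def)
    then have Xn: "X j \<in> dom_pow D A n" for j
      by (simp add: M_def)
    obtain x where x: "x \<in> dom_pow D A n" and lim: "(\<lambda>j. graph_dist A n (X j) x) \<longlonglongrightarrow> 0"
      using dom_pow_complete[of X n, OF Xn] X by (auto simp: MCauchy_def)
    have diff: "X j - x \<in> dom_pow D A n" "x - X j \<in> dom_pow D A n" for j
      using Xn x by (auto intro: cvec.subspace_diff[OF subspace_dom_pow])
    have "norm (X j - x) \<le> graph_dist A n (X j) x" for j
      using norm_le_graph_norm[of "X j - x" A n] by (simp add: graph_norm_diff[OF Xn x])
    then have "(\<lambda>j. X j - x) \<longlonglongrightarrow> 0"
      by (intro Lim_null_comparison[OF _ lim] always_eventually) simp
    then have "X \<longlonglongrightarrow> x"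
      by (rule LIM_zero_cancel)
    then have "(\<lambda>j. cinner (X j) \<psi>0s) \<longlonglongrightarrow> cinner x \<psi>0s"
      by (rule bounded_linear.tendsto[OF bounded_linear_cinner_left])
    moreover have "cinner (X j) \<psi>0s = 0" for j
      using XM by (simp add: M_def)
    ultimately have "cinner x \<psi>0s = 0"
      by (simp add: LIMSEQ_const_iff)
    \<comment> \<open>The triangle inequality compares \<open>x\<close> with \<open>X j\<close>, and
      the error, measured by the graph distance, tends to zero.\<close>
    moreover have "normY x \<le> r + k2 / k1 * 0"
    proof (rule LIMSEQ_le_const)
      show "(\<lambda>j. r + k2 / k1 * graph_dist A n (X j) x) \<longlonglongrightarrow> r + k2 / k1 * 0"
        by (intro tendsto_intros lim)
      have "normY x \<le> r + k2 / k1 * graph_dist A n (X j) x" for j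
        using normY_triangle[OF Y[OF diff(2)[of j]] Y[OF Xn[of j]]] XM[of j]
          normY_le_graph_norm[OF diff(2)[of j]]
        by (simp add: M_def graph_norm_diff[OF x Xn] graph_dist_commute[of A n x])
      then show "\<exists>N. \<forall>j\<ge>N. normY x \<le> r + k2 / k1 * graph_dist A n (X j) x" by blast
    qed
    ultimately have "x \<in> M"
      using x by (simp add: M_def)
    then show "\<exists>x. limitin mtopology X x sequentially"
      using XM lim by (auto simp: limitin_metric_dist_null)
  qed
  moreover have "0 \<in> M"
    using r cvec.subspace_0[OF subspace_dom_pow] normY_eq_0[OF Y, of 0] by (simp add: M_def)
  ultimately obtain a where a: "a \<in> M" "T a = a"
    using Banach_fixedpoint_thm[of T q] T_M T_contraction contraction unfolding q_def by blast
  moreover have "b = a" if b: "b \<in> M" "T b = b" for b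
  proof (rule ccontr)
    assume "b \<noteq> a"
    then have "0 < graph_dist A n b a"
      using a b nonneg[of b a] zero[of b a] by linarith
    then have "q * graph_dist A n b a < 1 * graph_dist A n b a"
      using contraction by (intro mult_strict_right_mono) (simp_all add: q_def)
    with T_contraction[OF b(1) a(1)] a b show False by simp
  qed
  ultimately show ?thesis
    unfolding M_def T_def by blast
qed

section \<open>Solvability for small parameters\<close>

lemma \<kappa>_mono: "s \<le> t \<Longrightarrow> \<kappa> s \<le> \<kappa> t"
  using k1_pos L_pos onorm_P_nonneg by (simp add: \<kappa>_def mult_left_mono)

lemma \<kappa>_nonneg: "0 \<le> t \<Longrightarrow> 0 \<le> \<kappa> t"
  using k1_pos L_pos onorm_P_nonneg onorm_Q_nonneg by (simp add: \<kappa>_def)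

text \<open>The radius is 0, which forces the corrector to vanish, while every \<sigma> of modulus
  at most \<open>\<rho>\<close> solves the system. Hence uniqueness is asserted for the corrector
  alone.\<close>

lemma solution_at_zero:
  assumes "0 \<le> \<rho>"
  shows "\<exists>!\<xi>. \<exists>\<sigma>. solves_system D A Y f \<mu>0 \<psi>0 \<psi>0s \<nu>1 \<phi>1 0 \<sigma> \<xi> \<and> cmod \<sigma> \<le> \<rho> \<and> normY \<xi> \<le> 0"
proof (rule ex1I)
  have 0: "0 \<in> dom_pow D A n"
    by (rule cvec.subspace_0[OF subspace_dom_pow])
  have "S 0 = 0"
    by (rule S_eqI) (simp_all add: cvec.subspace_0[OF subspace_D] A_zero)
  then show "\<exists>\<sigma>. solves_system D A Y f \<mu>0 \<psi>0 \<psi>0s \<nu>1 \<phi>1 0 \<sigma> 0 \<and> cmod \<sigma> \<le> \<rho> \<and> normY 0 \<le> 0"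
    using assms 0 normY_eq_0[of 0] dom_subset_Y
    by (intro exI[of _ 0]) (auto simp: solves_system_iff F_def)
next
  fix \<xi> assume "\<exists>\<sigma>. solves_system D A Y f \<mu>0 \<psi>0 \<psi>0s \<nu>1 \<phi>1 0 \<sigma> \<xi> \<and> cmod \<sigma> \<le> \<rho> \<and> normY \<xi> \<le> 0"
  then show "\<xi> = 0"
    using normY_nonneg[of \<xi>] normY_eq_0[of \<xi>] dom_subset_Y by (auto simp: solves_system_iff)
qed

lemma small_solution:
  assumes C: "C > 0" "\<And>\<eta>. \<eta> \<in> Q ` dom_pow D A (n - 1) \<Longrightarrow>
        graph_norm A n (S \<eta>) \<le> C * graph_norm A (n - 1) \<eta>"
    and r2_bounded: "r2 \<in> O[at 0](\<lambda>_. 1)"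
    and \<rho>1: "\<rho>1 > k1 * L * onorm P * normY \<phi>1" "\<forall>\<^sub>F \<epsilon> in nhds 0. r1 \<epsilon> \<ge> \<rho>1"
    and \<rho>2: "\<rho>2 > k2 * C * (cmod \<nu>1 + onorm Q * L) * normY \<phi>1" "\<forall>\<^sub>F \<epsilon> in nhds 0. r2 \<epsilon> \<ge> \<rho>2"
  shows "\<forall>\<^sub>F \<epsilon> in at 0. \<exists>a s. \<forall>\<sigma> \<xi>.
    solves_system D A Y f \<mu>0 \<psi>0 \<psi>0s \<nu>1 \<phi>1 \<epsilon> \<sigma> \<xi> \<and> cmod \<sigma> \<le> r1 \<epsilon> \<and> normY \<xi> \<le> r2 \<epsilon> * \<epsilon>\<^sup>2
    \<longleftrightarrow> \<sigma> = s \<and> \<xi> = a"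
proof -
  obtain M where M: "M > 0" "\<forall>\<^sub>F \<epsilon> in at 0. norm (r2 \<epsilon>) \<le> M * norm (1 :: real)"
    using r2_bounded by (rule landau_o.bigE)
  define N where "N = normY \<phi>1"
  have N: "N \<ge> 0" by (simp add: N_def normY_nonneg \<phi>1_Y)
  define p where "p = k1 * L * onorm P"
  have p: "p \<ge> 0" using k1_pos L_pos onorm_P_nonneg by (simp add: p_def)
  have "0 \<le> k2 * C * (cmod \<nu>1 + onorm Q * L) * normY \<phi>1"
    using k2_pos C(1) L_pos onorm_Q_nonneg N by (simp add: N_def)
  then have "\<rho>2 > 0" using \<rho>2(1) by linarith
  \<comment> \<open>A majorant of \<open>\<tau>\<close>: the first summand comes from
    \<open>\<epsilon> *\<^sub>R \<phi>1\<close>, the second from the radius, with \<open>r2\<close>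
    replaced by its bound \<open>M\<close>.\<close>
  define t where "t \<epsilon> = \<bar>\<epsilon>\<bar> * (N + M * \<bar>\<epsilon>\<bar>)" for \<epsilon> :: real
  have t: "(t \<longlongrightarrow> 0) (at 0)"
    unfolding t_def by (rule tendsto_eq_intros refl | simp)+
  have "((\<lambda>\<epsilon>. k2 * C * \<bar>\<epsilon>\<bar> * \<kappa> (2 * t \<epsilon>)) \<longlongrightarrow> 0) (at 0)"
    unfolding \<kappa>_def by (rule tendsto_eq_intros t refl | simp)+
  then have "\<forall>\<^sub>F \<epsilon> in at 0. k2 * C * \<bar>\<epsilon>\<bar> * \<kappa> (2 * t \<epsilon>) < 1"
    by (rule order_tendstoD) simp
  \<comment> \<open>This is the invariance bound divided by \<epsilon>^2. Its limit is the threshold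
    for \<open>r2\<close>, which the constant \<open>\<rho>2\<close> exceeds by a margin independent
    of \<epsilon>.\<close>
  moreover have "((\<lambda>\<epsilon>. k2 * C * \<kappa> (t \<epsilon>) * (N + M * \<bar>\<epsilon>\<bar>))
      \<longlongrightarrow> k2 * C * (cmod \<nu>1 + onorm Q * L) * N) (at 0)"
    unfolding \<kappa>_def by (rule tendsto_eq_intros t refl | simp)+
  then have "\<forall>\<^sub>F \<epsilon> in at 0. k2 * C * \<kappa> (t \<epsilon>) * (N + M * \<bar>\<epsilon>\<bar>) < \<rho>2"
    by (rule order_tendstoD) (use \<rho>2 in \<open>simp add: N_def\<close>)
  moreover have "((\<lambda>\<epsilon>. p * (N + M * \<bar>\<epsilon>\<bar>)) \<longlongrightarrow> p * N) (at 0)"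
    by (rule tendsto_eq_intros refl | simp)+
  then have "\<forall>\<^sub>F \<epsilon> in at 0. p * (N + M * \<bar>\<epsilon>\<bar>) < \<rho>1"
    by (rule order_tendstoD) (use \<rho>1 in \<open>simp add: N_def p_def\<close>)
  moreover have "\<forall>\<^sub>F \<epsilon> in at 0. t \<epsilon> < rL"
    by (rule order_tendstoD(2)[OF t rL_pos])
  moreover have "\<forall>\<^sub>F \<epsilon> in at 0. r1 \<epsilon> \<ge> \<rho>1" "\<forall>\<^sub>F \<epsilon> in at 0. r2 \<epsilon> \<ge> \<rho>2"
    using \<rho>1(2) \<rho>2(2) by (auto simp: eventually_at_filter elim: eventually_mono)
  moreover have "\<forall>\<^sub>F \<epsilon> in at 0. \<epsilon> \<noteq> (0 :: real)"
    by (simp add: eventually_at_filter)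
  ultimately show ?thesis
    using M(2)
  proof eventually_elim
    case (elim \<epsilon>)
    define r where "r = r2 \<epsilon> * \<epsilon>\<^sup>2"
    define \<tau> where "\<tau> = \<bar>\<epsilon>\<bar> * normY \<phi>1 + r"
    have r: "0 \<le> r" using elim \<open>\<rho>2 > 0\<close> by (simp add: r_def)
    have "r2 \<epsilon> \<le> M" using elim by simp
    then have "r \<le> M * \<epsilon>\<^sup>2" unfolding r_def by (intro mult_right_mono) auto
    then have \<tau>_le: "\<tau> \<le> t \<epsilon>"
      by (simp add: \<tau>_def t_def N_def algebra_simps power2_eq_square)
    have \<tau>: "0 \<le> \<tau>" using r N by (simp add: \<tau>_def N_def)
    have "\<tau> < rL" using \<tau>_le elim by linarith
    have "k2 * C * \<bar>\<epsilon>\<bar> * \<kappa> (2 * \<tau>) \<le> k2 * C * \<bar>\<epsilon>\<bar> * \<kappa> (2 * t \<epsilon>)"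
      using \<tau>_le k2_pos C(1) by (intro mult_left_mono \<kappa>_mono) auto
    then have contraction: "k2 * C * \<bar>\<epsilon>\<bar> * \<kappa> (2 * \<tau>) < 1" using elim by linarith
    have "k2 * C * \<bar>\<epsilon>\<bar> * \<kappa> \<tau> * \<tau> \<le> k2 * C * \<bar>\<epsilon>\<bar> * \<kappa> (t \<epsilon>) * t \<epsilon>"
      using \<tau>_le \<tau> k2_pos C(1) by (intro mult_mono mult_left_mono \<kappa>_mono mult_nonneg_nonneg \<kappa>_nonneg) auto
    also have "\<dots> = k2 * C * \<kappa> (t \<epsilon>) * (\<bar>\<epsilon>\<bar> * t \<epsilon>)"
      by (simp only: mult_ac)
    \<comment> \<open>One factor |\<epsilon>| stems from the fixed point map, the other from the
      size of its argument; together they match the radius of order \<epsilon>^2.\<close>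
    also have "\<bar>\<epsilon>\<bar> * t \<epsilon> = (N + M * \<bar>\<epsilon>\<bar>) * \<epsilon>\<^sup>2"
      unfolding t_def power2_eq_square abs_mult_self_eq[of \<epsilon>, symmetric] by (simp only: mult_ac)
    also have "k2 * C * \<kappa> (t \<epsilon>) * ((N + M * \<bar>\<epsilon>\<bar>) * \<epsilon>\<^sup>2) = k2 * C * \<kappa> (t \<epsilon>) * (N + M * \<bar>\<epsilon>\<bar>) * \<epsilon>\<^sup>2"
      by (simp only: mult_ac)
    also have "\<dots> \<le> r"
      unfolding r_def using elim by (intro mult_right_mono) auto
    finally have "k2 * C * \<bar>\<epsilon>\<bar> * \<kappa> \<tau> * \<tau> \<le> r" .
    then obtain a where a: "\<And>b. b \<in> dom_pow D A n \<and> cinner b \<psi>0s = 0 \<and> normY b \<le> r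
        \<and> S (\<epsilon> *\<^sub>R G \<epsilon> b) = b \<longleftrightarrow> b = a"
      using ex1_fixed_point[OF C r \<tau>_def \<open>\<tau> < rL\<close> contraction] by metis
    \<comment> \<open>The scalar equation solved for \<sigma>. The division by \<epsilon> is
      harmless for the bound because \<open>t \<epsilon>\<close> contains a factor
      |\<epsilon>|.\<close>
    define s where "s = - cinner (F \<epsilon> a) \<psi>0s / of_real \<epsilon>"
    have "cmod s \<le> r1 \<epsilon>"
    proof -
      have an: "a \<in> dom_pow D A n" "normY a \<le> r" using a[of a] by auto
      then have "normY (a + \<epsilon> *\<^sub>R \<phi>1) \<le> \<tau>"
        using normY_triangle[OF subsetD[OF dom_subset_Y an(1)]
            subsetD[OF dom_subset_Y dom_pow_scaleR[OF \<phi>1_dom_pow, of \<epsilon>]]]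
        by (simp add: \<tau>_def normY_scaleR \<phi>1_Y)
      then have "cmod (cinner (F \<epsilon> a) \<psi>0s) \<le> p * \<tau>"
        using cinner_F_le[OF an(1) _ \<open>\<tau> < rL\<close>] by (simp add: p_def)
      also have "\<dots> \<le> p * t \<epsilon>"
        using p \<tau>_le by (rule mult_left_mono[rotated])
      also have "\<dots> = (p * (N + M * \<bar>\<epsilon>\<bar>)) * \<bar>\<epsilon>\<bar>"
        by (simp add: t_def)
      finally have "cmod s \<le> p * (N + M * \<bar>\<epsilon>\<bar>)"
        using elim by (simp add: s_def norm_divide pos_divide_le_eq)
      then show ?thesis using elim by linarith
    qed
    have "of_real \<epsilon> * \<sigma> = - cinner (F \<epsilon> a) \<psi>0s \<longleftrightarrow> \<sigma> = s" for \<sigma>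
      using elim by (auto simp: s_def field_simps)
    then have "solves_system D A Y f \<mu>0 \<psi>0 \<psi>0s \<nu>1 \<phi>1 \<epsilon> \<sigma> \<xi> \<and> cmod \<sigma> \<le> r1 \<epsilon> \<and> normY \<xi> \<le> r
        \<longleftrightarrow> \<sigma> = s \<and> \<xi> = a" for \<sigma> \<xi>
      unfolding solves_system_iff using a[of \<xi>] \<open>cmod s \<le> r1 \<epsilon>\<close> by blast
    then show ?case
      unfolding r_def by blast
  qed
qed

end

theorem theorem3p1:
  fixes D :: "'h::complex_hilbert_space set"
    and A :: "'h \<Rightarrow> 'h"
    and Y :: "'h set"
    and normY :: "'h \<Rightarrow> real"
    and f :: "'h \<Rightarrow> 'h"
    and n :: nat
    and k1 k2 :: real
    and \<mu>0 :: complex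
    and \<psi>0 \<psi>0s :: 'h
    and rL L :: real
  assumes "basic_assumption D A Y normY f n k1 k2 \<mu>0 \<psi>0 \<psi>0s rL L"
  defines "P0 \<equiv> P0_proj \<psi>0 \<psi>0s"
    and "Q0 \<equiv> Q0_proj \<psi>0 \<psi>0s"
    and "\<nu> \<equiv> - cinner (f \<psi>0) \<psi>0s"
  shows "\<exists>\<phi> \<in> Q0 ` D \<inter> Y.
    (\<forall>\<phi>' \<in> Q0 ` D. A \<phi>' - \<mu>0 *\<^sub>C \<phi>' = \<nu> *\<^sub>C \<psi>0 + f \<psi>0 \<longleftrightarrow> \<phi>' = \<phi>) \<and>
    (\<forall>(\<epsilon>::real) (\<mu>::complex) \<psi>.
       \<psi> \<in> D \<inter> Y \<and> (A \<psi> - \<mu> *\<^sub>C \<psi>) - \<epsilon> *\<^sub>R f \<psi> = 0 \<and> cinner \<psi> \<psi>0s = 1 \<longrightarrow>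
       (\<exists>\<sigma> \<xi>. \<mu> = \<mu>0 + complex_of_real \<epsilon> * \<nu> + complex_of_real (\<epsilon>\<^sup>2) * \<sigma> \<and>
               \<psi> = \<psi>0 + \<epsilon> *\<^sub>R \<phi> + \<xi> \<and>
               \<xi> \<in> Q0 ` D \<and>
               solves_system D A Y f \<mu>0 \<psi>0 \<psi>0s \<nu> \<phi> \<epsilon> \<sigma> \<xi>)) \<and>
    (\<forall>C>0. (\<forall>\<eta> \<in> Q0 ` dom_pow D A (n - 1).
               graph_norm A n (compressed_inverse D A \<mu>0 Q0 \<eta>) \<le> C * graph_norm A (n - 1) \<eta>) \<longrightarrow>
       (\<forall>r1 r2 :: real \<Rightarrow> real.
          r1 \<in> O[at 0](\<lambda>_. 1) \<and> r2 \<in> O[at 0](\<lambda>_. 1) \<and>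
          (\<exists>\<rho>1 > k1 * L * onorm P0 * normY \<phi>. \<forall>\<^sub>F \<epsilon> in nhds 0. r1 \<epsilon> \<ge> \<rho>1) \<and>
          (\<exists>\<rho>2 > k2 * C * (cmod \<nu> + onorm Q0 * L) * normY \<phi>. \<forall>\<^sub>F \<epsilon> in nhds 0. r2 \<epsilon> \<ge> \<rho>2) \<longrightarrow>
          (\<exists>\<epsilon>0>0. \<forall>\<epsilon>\<in>{-\<epsilon>0<..<\<epsilon>0}.
             (\<exists>!\<xi>. \<exists>\<sigma>. solves_system D A Y f \<mu>0 \<psi>0 \<psi>0s \<nu> \<phi> \<epsilon> \<sigma> \<xi> \<and>
                       cmod \<sigma> \<le> r1 \<epsilon> \<and> normY \<xi> \<le> r2 \<epsilon> * \<epsilon>\<^sup>2) \<and>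
             (\<epsilon> \<noteq> 0 \<longrightarrow>
              (\<exists>!(\<sigma>, \<xi>). solves_system D A Y f \<mu>0 \<psi>0 \<psi>0s \<nu> \<phi> \<epsilon> \<sigma> \<xi> \<and>
                         cmod \<sigma> \<le> r1 \<epsilon> \<and> normY \<xi> \<le> r2 \<epsilon> * \<epsilon>\<^sup>2)))))"
proof -
  interpret basic_assumption D A Y normY f n k1 k2 \<mu>0 \<psi>0 \<psi>0s rL L
    by fact
  note [simp] = \<nu>_def[folded \<nu>1_def] P0_def Q0_def
  show ?thesis
  proof (intro bexI[of _ \<phi>1] conjI allI impI ballI)
    show "\<phi>1 \<in> Q0 ` D \<inter> Y"
      by (simp add: mem_Q_D \<phi>1_D cinner_\<phi>1 \<phi>1_Y)
    show "A \<phi>' - \<mu>0 *\<^sub>C \<phi>' = \<nu> *\<^sub>C \<psi>0 + f \<psi>0 \<longleftrightarrow> \<phi>' = \<phi>1" if "\<phi>' \<in> Q0 ` D" for \<phi>'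
      using first_order_unique[of \<phi>'] that by simp
    show "\<exists>\<sigma> \<xi>. \<mu> = \<mu>0 + complex_of_real \<epsilon> * \<nu> + complex_of_real (\<epsilon>\<^sup>2) * \<sigma> \<and>
        \<psi> = \<psi>0 + \<epsilon> *\<^sub>R \<phi>1 + \<xi> \<and> \<xi> \<in> Q0 ` D \<and> solves_system D A Y f \<mu>0 \<psi>0 \<psi>0s \<nu> \<phi>1 \<epsilon> \<sigma> \<xi>"
      if "\<psi> \<in> D \<inter> Y \<and> (A \<psi> - \<mu> *\<^sub>C \<psi>) - \<epsilon> *\<^sub>R f \<psi> = 0 \<and> cinner \<psi> \<psi>0s = 1" for \<epsilon> \<mu> \<psi>
      using decomposition[of \<psi> \<mu> \<epsilon>] that by simp
  next
    fix C :: real and r1 r2 :: "real \<Rightarrow> real"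
    assume C: "C > 0" "\<forall>\<eta> \<in> Q0 ` dom_pow D A (n - 1).
        graph_norm A n (compressed_inverse D A \<mu>0 Q0 \<eta>) \<le> C * graph_norm A (n - 1) \<eta>"
      and "r1 \<in> O[at 0](\<lambda>_. 1) \<and> r2 \<in> O[at 0](\<lambda>_. 1) \<and>
          (\<exists>\<rho>1 > k1 * L * onorm P0 * normY \<phi>1. \<forall>\<^sub>F \<epsilon> in nhds 0. r1 \<epsilon> \<ge> \<rho>1) \<and>
          (\<exists>\<rho>2 > k2 * C * (cmod \<nu> + onorm Q0 * L) * normY \<phi>1. \<forall>\<^sub>F \<epsilon> in nhds 0. r2 \<epsilon> \<ge> \<rho>2)"
    then obtain \<rho>1 \<rho>2 where r2: "r2 \<in> O[at 0](\<lambda>_. 1)"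
      and \<rho>1: "\<rho>1 > k1 * L * onorm P * normY \<phi>1" "\<forall>\<^sub>F \<epsilon> in nhds 0. r1 \<epsilon> \<ge> \<rho>1"
      and \<rho>2: "\<rho>2 > k2 * C * (cmod \<nu>1 + onorm Q * L) * normY \<phi>1" "\<forall>\<^sub>F \<epsilon> in nhds 0. r2 \<epsilon> \<ge> \<rho>2"
      by auto
    let ?sol = "\<lambda>\<epsilon> \<sigma> \<xi>. solves_system D A Y f \<mu>0 \<psi>0 \<psi>0s \<nu> \<phi>1 \<epsilon> \<sigma> \<xi> \<and>
      cmod \<sigma> \<le> r1 \<epsilon> \<and> normY \<xi> \<le> r2 \<epsilon> * \<epsilon>\<^sup>2"
    have "graph_norm A n (S \<eta>) \<le> C * graph_norm A (n - 1) \<eta>" if "\<eta> \<in> Q ` dom_pow D A (n - 1)" for \<eta>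
      using C(2) that unfolding Q0_def by blast
    from small_solution[OF C(1) this r2 \<rho>1 \<rho>2]
    have "\<forall>\<^sub>F \<epsilon> in at 0. \<exists>a s. \<forall>\<sigma> \<xi>. ?sol \<epsilon> \<sigma> \<xi> \<longleftrightarrow> \<sigma> = s \<and> \<xi> = a"
      by simp
    then obtain \<epsilon>0 where \<epsilon>0: "\<epsilon>0 > 0"
      and sol: "\<And>\<epsilon>. \<epsilon> \<noteq> 0 \<Longrightarrow> dist \<epsilon> 0 < \<epsilon>0 \<Longrightarrow> \<exists>a s. \<forall>\<sigma> \<xi>. ?sol \<epsilon> \<sigma> \<xi> \<longleftrightarrow> \<sigma> = s \<and> \<xi> = a"
      unfolding eventually_at by blast
    \<comment> \<open>The lower bound on \<open>r1\<close> holds on a full neighbourhood, hence at 0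
      itself, which makes \<sigma> = 0 admissible there.\<close>
    have zero: "\<exists>!\<xi>. \<exists>\<sigma>. ?sol 0 \<sigma> \<xi>"
    proof -
      have "0 \<le> k1 * L * onorm P * normY \<phi>1"
        using k1_pos L_pos onorm_P_nonneg normY_nonneg[OF \<phi>1_Y] by simp
      then have "0 \<le> r1 0"
        using \<rho>1(1) eventually_nhds_x_imp_x[OF \<rho>1(2)] by linarith
      then show ?thesis
        using solution_at_zero[of "r1 0"] by simp
    qed
    show "\<exists>\<epsilon>0>0. \<forall>\<epsilon>\<in>{-\<epsilon>0<..<\<epsilon>0}.
        (\<exists>!\<xi>. \<exists>\<sigma>. ?sol \<epsilon> \<sigma> \<xi>) \<and> (\<epsilon> \<noteq> 0 \<longrightarrow> (\<exists>!(\<sigma>, \<xi>). ?sol \<epsilon> \<sigma> \<xi>))"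
    proof (intro exI[of _ \<epsilon>0] conjI \<epsilon>0 ballI)
      fix \<epsilon> assume \<epsilon>: "\<epsilon> \<in> {-\<epsilon>0<..<\<epsilon>0}"
      show "(\<exists>!\<xi>. \<exists>\<sigma>. ?sol \<epsilon> \<sigma> \<xi>)" "\<epsilon> \<noteq> 0 \<longrightarrow> (\<exists>!(\<sigma>, \<xi>). ?sol \<epsilon> \<sigma> \<xi>)"
      proof (atomize(full), cases "\<epsilon> = 0")
        case False
        then obtain a s where "\<And>\<sigma> \<xi>. ?sol \<epsilon> \<sigma> \<xi> \<longleftrightarrow> \<sigma> = s \<and> \<xi> = a"
          using sol[of \<epsilon>] \<epsilon> by (auto simp: dist_norm abs_less_iff)
        then show "(\<exists>!\<xi>. \<exists>\<sigma>. ?sol \<epsilon> \<sigma> \<xi>) \<and> (\<epsilon> \<noteq> 0 \<longrightarrow> (\<exists>!(\<sigma>, \<xi>). ?sol \<epsilon> \<sigma> \<xi>))"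
          by simp (auto intro!: ex1I[of _ "(s, a)"])
      qed (use zero in simp)
    qed
  qed
qed

end
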